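(* Let $(I_n,A,B,Q,S,R)\in\Sigma^w_{m,n}(\mathbb K)$ and consider the associated palindromic pencil $z\mathcal A^*-\mathcal A$. Let $q=\operatorname{rk}_{\mathbb K(z)}\Phi(z)$ and assume that $\operatorname{rk}\begin{bmatrix}I_n-A&-B\end{bmatrix}=n$. Then the following are equivalent: (a) There exists a solution $(X,K,L)\in\mathbb K^{n\times n}\times\mathbb K^{q\times n}\times\mathbb K^{q\times m}$ of the Lur'e equation $$\begin{bmatrix}A^*XA-X+Q&A^*XB+S\\ B^*XA+S^*&B^*XB+R\end{bmatrix}=\begin{bmatrix}K^*\\ L^*\end{bmatrix}\begin{bmatrix}K&L\end{bmatrix},\qquad X=X^*.$$ (b) It holds that $\Phi(e^{i\omega})\succeq0$ for all $\omega\in[0,2\pi)$ with $\det(e^{i\omega}I_n-A)\neq0$. Furthermore, there exist matrices $Y_\mu,Y_x\in\mathbb K^{n\times(n+m)}$, $Y_u\in\mathbb K^{m\times(n+m)}$ and $Z_\mu,Z_x\in\mathbb K^{n\times(n+q)}$, $Z_u\in\mathbb K^{m\times(n+q)}$ such that for $$Y=\begin{bmatrix}Y_\mu\\ Y_x\\ Y_u\end{bmatrix},\qquad Z=\begin{bmatrix}Z_\mu\\ Z_x\\ Z_u\end{bmatrix}$$ the following hold: (i) the matrix $\begin{bmatrix}I_n-A&-B\end{bmatrix}\begin{bmatrix}Y_x\\ Y_u\end{bmatrix}$ has full row rank $n$; (ii) the space $\mathcal Y=\operatorname{im}Y$ is maximally $(\mathcal A^*-\mathcal A)$-neutral; (iii)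 there exist $\tilde E,\tilde A\in\mathbb K^{(n+q)\times(n+m)}$ such that $(z\mathcal A^*-\mathcal A)Y=Z(z\tilde E-\tilde A)$.
   Context: $\mathbb K\in\{\mathbb R,\mathbb C\}$. $(I_n,A,B,Q,S,R)\in\Sigma^w_{m,n}(\mathbb K)$ means $A\in\mathbb K^{n\times n}$, $B\in\mathbb K^{n\times m}$, $Q=Q^*\in\mathbb K^{n\times n}$, $S\in\mathbb K^{n\times m}$, $R=R^*\in\mathbb K^{m\times m}$ (with $E=I_n$). Popov function: $\Phi(z)=\begin{bmatrix}(zI_n-A)^{-1}B\\ I_m\end{bmatrix}^{\sim}\begin{bmatrix}Q&S\\ S^*&R\end{bmatrix}\begin{bmatrix}(zI_n-A)^{-1}B\\ I_m\end{bmatrix}\in\mathbb K(z)^{m\times m}$, where $G^\sim(z)=G(\overline z^{\,-1})^*$; $\operatorname{rk}_{\mathbb K(z)}$ is the rank over the field of rational functions. The associated palindromic pencil is $$z\mathcal A^*-\mathcal A=\begin{bmatrix}0&zI_n-A&-B\\ zA^*-I_n&(z-1)Q&(z-1)S\\ zB^*&(z-1)S^*&(z-1)R\end{bmatrix}\in\mathbb K[z]^{(2n+m)\times(2n+m)},\qquad \mathcal A=\begin{bmatrix}0&A&B\\ I_n&Q&S\\ 0&S^*&R\end{bmatrix}.$$ For $M\in\mathbb K^{N\times N}$, a subspace $\mathcal Y\subseteq\mathbb K^N$ is $M$-neutral if $x^*My=0$ for all $x,y\in\mathcal Y$; it is maximally $M$-neutral if it is $M$-neutral and no proper superspace of it is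 $M$-neutral. *)

theory Defs
  imports
    "Jordan_Normal_Form.Schur_Decomposition"
    "Jordan_Normal_Form.DL_Rank"
    "Jordan_Normal_Form.Char_Poly"
begin

text \<open>The base field: a field with conjugation that is identified by \<open>to_complex\<close> with
  the real or the complex numbers, the conjugation being the usual one.\<close>

class real_or_complex = conjugatable_field +
  fixes to_complex :: "'a \<Rightarrow> complex"
  assumes to_complex_add: "to_complex (x + y) = to_complex x + to_complex y"
    and to_complex_mult: "to_complex (x * y) = to_complex x * to_complex y"
    and to_complex_one: "to_complex 1 = 1"
    and to_complex_conjugate: "to_complex (conjugate x) = cnj (to_complex x)"
    and range_to_complex: "range to_complex = \<real> \<or> range to_complex = UNIV"

instantiation real :: real_or_complex
begin
definition to_complex_real_def [simp]: "to_complex (x :: real) = complex_of_real x"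
instance by standard (auto simp: Reals_def to_complex_real_def)
end

instantiation complex :: real_or_complex
begin
definition to_complex_complex_def [simp]: "to_complex (x :: complex) = x"
instance by standard (auto simp: to_complex_complex_def)
end

lemma field_hom_to_complex: "field_hom (to_complex :: 'a :: real_or_complex \<Rightarrow> complex)"
proof
  show "to_complex (0 :: 'a) = 0"
    using to_complex_add[of "0 :: 'a" 0] by simp
qed (simp_all add: to_complex_add to_complex_mult to_complex_one)


section \<open>Rational functions\<close>

text \<open>Rational functions over \<^typ>\<open>'a\<close> are elements of \<^typ>\<open>'a poly fract\<close>.\<close>

definition zvar :: "'a :: field poly fract" where
  "zvar = to_fract [:0, 1:]"

definition const_fract :: "'a :: field \<Rightarrow> 'a poly fract" where
  "const_fract c = to_fract [:c:]"

text \<open>The value of a rational function at a complex point that is not a pole; it is unspecified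
  at the poles.\<close>

definition rat_eval :: "complex \<Rightarrow> 'a :: real_or_complex poly fract \<Rightarrow> complex" where
  "rat_eval w r = (THE v. \<exists>p d. r = Fract p d \<and> poly (map_poly to_complex d) w \<noteq> 0 \<and>
     v = poly (map_poly to_complex p) w / poly (map_poly to_complex d) w)"

text \<open>For scalar \<open>r\<close>, the rational function whose value at \<open>z\<close> is the conjugate of the value of
  \<open>r\<close> at \<open>1 / cnj z\<close>: conjugate all coefficients and substitute the inverse of the
  indeterminate.\<close>

definition para_conj_poly :: "'a :: real_or_complex poly \<Rightarrow> 'a poly fract" where
  "para_conj_poly p = poly (map_poly (\<lambda>c. const_fract (conjugate c)) p) (inverse zvar)"

definition para_conj :: "'a :: real_or_complex poly fract \<Rightarrow> 'a poly fract" where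
  "para_conj r = (THE s. \<exists>p d. d \<noteq> 0 \<and> r = Fract p d \<and>
     s = para_conj_poly p / para_conj_poly d)"

definition para_adjoint :: "'a :: real_or_complex poly fract mat \<Rightarrow> 'a poly fract mat" where
  "para_adjoint G = transpose_mat (map_mat para_conj G)"

lemma rat_eval_Fract:
  fixes p d :: "'a :: real_or_complex poly"
  assumes d: "poly (map_poly to_complex d) w \<noteq> 0"
  shows "rat_eval w (Fract p d) =
    poly (map_poly to_complex p) w / poly (map_poly to_complex d) w"
  unfolding rat_eval_def
proof (rule the_equality)
  interpret field_hom "to_complex :: 'a \<Rightarrow> complex" by (rule field_hom_to_complex)
  interpret mp: map_poly_comm_ring_hom "to_complex :: 'a \<Rightarrow> complex" ..
  fix v
  assume "\<exists>p' d'. Fract p d = Fract p' d' \<and> poly (map_poly to_complex d') w \<noteq> 0 \<and>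
     v = poly (map_poly to_complex p') w / poly (map_poly to_complex d') w"
  then obtain p' d' where eq: "Fract p d = Fract p' d'"
    and d': "poly (map_poly to_complex d') w \<noteq> 0"
    and v: "v = poly (map_poly to_complex p') w / poly (map_poly to_complex d') w"
    by blast
  have "d \<noteq> 0" "d' \<noteq> 0" using d d' by auto
  then have "p * d' = p' * d" using eq by (simp add: eq_fract)
  then have "poly (map_poly to_complex (p * d')) w = poly (map_poly to_complex (p' * d)) w"
    by simp
  then show "v = poly (map_poly to_complex p) w / poly (map_poly to_complex d) w"
    using d d' by (simp add: v mp.hom_mult frac_eq_eq)
qed (use d in blast)

lemma comm_ring_hom_const_conj:
  "comm_ring_hom (\<lambda>c :: 'a :: real_or_complex. const_fract (conjugate c))"
proof -
  have one: "conjugate 1 = (1 :: 'a)"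
    by (metis conjugate_dist_mul conjugate_id mult.right_neutral mult.left_neutral)
  show ?thesis
    by standard
      (simp_all add: const_fract_def conjugate_dist_mul conjugate_dist_add one
        flip: to_fract_mult to_fract_add one_pCons)
qed

lemma para_conj_poly_mult: "para_conj_poly (p * q) = para_conj_poly p * para_conj_poly q"
proof -
  interpret comm_ring_hom "\<lambda>c :: 'a. const_fract (conjugate c)" by (rule comm_ring_hom_const_conj)
  interpret mp: map_poly_comm_ring_hom "\<lambda>c :: 'a. const_fract (conjugate c)" ..
  show ?thesis by (simp add: para_conj_poly_def mp.hom_mult)
qed

lemma const_fract_0 [simp]: "const_fract 0 = 0"
  by (simp add: const_fract_def)

lemma para_conj_poly_eq_0_iff: "para_conj_poly p = 0 \<longleftrightarrow> p = 0"
proof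
  assume z: "para_conj_poly p = 0"
  let ?h = "\<lambda>c :: 'a. const_fract (conjugate c)"
  have h0: "?h c = 0 \<longleftrightarrow> c = 0" for c
    by (simp add: const_fract_def)
  have hom0: "conjugate 0 = (0 :: 'a)" by simp
  have ev: "poly (map_poly const_fract q) zvar = to_fract q" for q :: "'a poly"
  proof (induction q)
    case (pCons a q)
    have "pCons a q = [:a:] + [:0, 1:] * q" by simp
    then have "to_fract (pCons a q) = to_fract [:a:] + to_fract [:0, 1:] * to_fract q"
      by (metis to_fract_add to_fract_mult)
    then show ?case
      using pCons by (simp add: map_poly_pCons const_fract_def zvar_def)
  qed simp
  have refl: "reflect_poly (map_poly ?h p) = map_poly const_fract (reflect_poly (map_poly conjugate p))"
    (is "_ = map_poly _ ?r")
  proof (rule poly_eqI)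
    fix i
    have "degree (map_poly ?h p) = degree p" "degree (map_poly conjugate p) = degree p"
      by (auto intro!: degree_map_poly simp: h0)
    then show "coeff (reflect_poly (map_poly ?h p)) i = coeff (map_poly const_fract ?r) i"
      by (simp add: coeff_reflect_poly coeff_map_poly const_fract_def)
  qed
  have "(zvar :: 'a poly fract) \<noteq> 0" by (simp add: zvar_def)
  then have "poly (reflect_poly (map_poly ?h p)) zvar = zvar ^ degree (map_poly ?h p) * para_conj_poly p"
    by (simp add: poly_reflect_poly_nz para_conj_poly_def)
  then have "to_fract ?r = 0"
    unfolding refl ev using z by simp
  then have "map_poly conjugate p = 0" by simp
  then have "conjugate (coeff p i) = 0" for i
    by (metis coeff_0 coeff_map_poly hom0)
  then show "p = 0" by (simp add: poly_eq_iff)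
qed (simp add: para_conj_poly_def)

lemma para_conj_Fract:
  assumes d: "d \<noteq> 0"
  shows "para_conj (Fract p d) = para_conj_poly p / para_conj_poly d"
  unfolding para_conj_def
proof (rule the_equality)
  fix s
  assume "\<exists>p' d'. d' \<noteq> 0 \<and> Fract p d = Fract p' d' \<and> s = para_conj_poly p' / para_conj_poly d'"
  then obtain p' d' where d': "d' \<noteq> 0" and eq: "Fract p d = Fract p' d'"
    and s: "s = para_conj_poly p' / para_conj_poly d'"
    by blast
  have "para_conj_poly (p * d') = para_conj_poly (p' * d)"
    using eq d d' by (simp add: eq_fract)
  then show "s = para_conj_poly p / para_conj_poly d"
    using d d' by (simp add: s para_conj_poly_mult para_conj_poly_eq_0_iff frac_eq_eq)
qed (use d in blast)


section \<open>Matrices, Popov function and palindromic pencil\<close>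

definition append_cols :: "'a :: zero mat \<Rightarrow> 'a mat \<Rightarrow> 'a mat" (infixr "@\<^sub>c" 66) where
  "A @\<^sub>c B = four_block_mat A B (0\<^sub>m 0 (dim_col A)) (0\<^sub>m 0 (dim_col B))"

definition Sigma_w ::
  "nat \<Rightarrow> nat \<Rightarrow> ('a :: conjugatable_field mat \<times> 'a mat \<times> 'a mat \<times> 'a mat \<times> 'a mat) set" where
  "Sigma_w m n = {(A, B, Q, S, R).
     A \<in> carrier_mat n n \<and> B \<in> carrier_mat n m \<and>
     Q \<in> carrier_mat n n \<and> mat_adjoint Q = Q \<and> S \<in> carrier_mat n m \<and>
     R \<in> carrier_mat m m \<and> mat_adjoint R = R}"

text \<open>Over the field of rational functions the matrix \<open>z I - A\<close> is always invertible, so the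
  result of the library function \<^const>\<open>mat_inverse\<close> is never \<^const>\<open>None\<close> here.\<close>

definition popov ::
  "'a :: real_or_complex mat \<Rightarrow> 'a mat \<Rightarrow> 'a mat \<Rightarrow> 'a mat \<Rightarrow> 'a mat \<Rightarrow> 'a poly fract mat" where
  "popov A B Q S R =
    (let n = dim_row A; m = dim_col B;
         resolvent = the (mat_inverse (zvar \<cdot>\<^sub>m 1\<^sub>m n - map_mat const_fract A));
         G = (resolvent * map_mat const_fract B) @\<^sub>r 1\<^sub>m m
     in para_adjoint G * map_mat const_fract (four_block_mat Q S (mat_adjoint S) R) * G)"

lemma resolvent_inverse:
  fixes A :: "'a :: field mat"
  assumes A: "A \<in> carrier_mat n n"
  defines "M \<equiv> zvar \<cdot>\<^sub>m 1\<^sub>m n - map_mat const_fract A"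
  shows "the (mat_inverse M) \<in> carrier_mat n n"
    and "M * the (mat_inverse M) = 1\<^sub>m n"
    and "the (mat_inverse M) * M = 1\<^sub>m n"
proof -
  interpret comm_ring_hom "to_fract :: 'a poly \<Rightarrow> 'a poly fract"
    by standard simp_all
  have M: "M \<in> carrier_mat n n" using A unfolding M_def by auto
  have "M = map_mat to_fract (char_poly_matrix A)"
    using A unfolding M_def char_poly_matrix_def
    by (intro eq_matI)
      (auto simp: zvar_def const_fract_def simp flip: to_fract_uminus to_fract_diff)
  then have "det M = to_fract (char_poly A)"
    by (simp add: char_poly_def)
  moreover have "char_poly A \<noteq> 0"
    using degree_monic_char_poly[OF A] by auto
  ultimately have "M \<in> Units (ring_mat TYPE('a poly fract) n ())"
    using det_non_zero_imp_unit[OF M] by simp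
  then obtain N where "mat_inverse M = Some N"
    using mat_inverse(1)[OF M, where b = "()"] by (cases "mat_inverse M") blast+
  with mat_inverse(2)[OF M this]
  show "the (mat_inverse M) \<in> carrier_mat n n" "M * the (mat_inverse M) = 1\<^sub>m n"
    "the (mat_inverse M) * M = 1\<^sub>m n"
    by auto
qed

text \<open>The order on \<^typ>\<open>complex\<close> is the one of \<^theory>\<open>HOL-Library.Complex_Order\<close>:
  \<open>0 \<le> w\<close> means that \<open>w\<close> is real and nonnegative.\<close>

definition psd :: "complex mat \<Rightarrow> bool" where
  "psd M \<longleftrightarrow> mat_adjoint M = M \<and>
     (\<forall>x \<in> carrier_vec (dim_row M). 0 \<le> (M *\<^sub>v x) \<bullet>c x)"

text \<open>The matrix pencil \<open>z E - A\<close> as a polynomial matrix.\<close>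

definition pencil :: "'a :: comm_ring_1 mat \<Rightarrow> 'a mat \<Rightarrow> 'a poly mat" where
  "pencil E A = [:0, 1:] \<cdot>\<^sub>m map_mat (\<lambda>c. [:c:]) E - map_mat (\<lambda>c. [:c:]) A"

definition palindromic_mat ::
  "'a :: conjugatable_field mat \<Rightarrow> 'a mat \<Rightarrow> 'a mat \<Rightarrow> 'a mat \<Rightarrow> 'a mat \<Rightarrow> 'a mat" where
  "palindromic_mat A B Q S R =
    (let n = dim_row A; m = dim_col B in
       (0\<^sub>m n n @\<^sub>c A @\<^sub>c B) @\<^sub>r
       (1\<^sub>m n @\<^sub>c Q @\<^sub>c S) @\<^sub>r
       (0\<^sub>m m n @\<^sub>c mat_adjoint S @\<^sub>c R))"

definition palindromic_pencil ::
  "'a :: conjugatable_field mat \<Rightarrow> 'a mat \<Rightarrow> 'a mat \<Rightarrow> 'a mat \<Rightarrow> 'a mat \<Rightarrow> 'a poly mat" where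
  "palindromic_pencil A B Q S R =
    pencil (mat_adjoint (palindromic_mat A B Q S R)) (palindromic_mat A B Q S R)"

lemma palindromic_pencil_blocks:
  fixes A B Q S R :: "'a :: conjugatable_field mat"
  assumes "(A, B, Q, S, R) \<in> Sigma_w m n"
  defines "c \<equiv> map_mat (\<lambda>a :: 'a. [:a:])" and "z \<equiv> [:0, 1:]"
  shows "palindromic_pencil A B Q S R =
    (0\<^sub>m n n @\<^sub>c (z \<cdot>\<^sub>m 1\<^sub>m n - c A) @\<^sub>c (- c B)) @\<^sub>r
    ((z \<cdot>\<^sub>m c (mat_adjoint A) - 1\<^sub>m n) @\<^sub>c ((z - 1) \<cdot>\<^sub>m c Q) @\<^sub>c ((z - 1) \<cdot>\<^sub>m c S)) @\<^sub>r
    ((z \<cdot>\<^sub>m c (mat_adjoint B)) @\<^sub>c ((z - 1) \<cdot>\<^sub>m c (mat_adjoint S)) @\<^sub>c ((z - 1) \<cdot>\<^sub>m c R))"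
proof -
  have adj: "i < dim_col M \<Longrightarrow> j < dim_row M \<Longrightarrow> mat_adjoint M $$ (i, j) = conjugate (M $$ (j, i))"
    for M :: "'a mat" and i j
    by (simp add: mat_adjoint_def mat_of_rows_index)
  have dim: "dim_row (mat_adjoint M) = dim_col M" "dim_col (mat_adjoint M) = dim_row M"
    for M :: "'a mat"
    by (simp_all add: mat_adjoint_def)
  have Q: "conjugate (Q $$ (j, i)) = Q $$ (i, j)" if "i < n" "j < n" for i j
    using assms(1) adj[of i Q j] that by (auto simp: Sigma_w_def)
  have R: "conjugate (R $$ (j, i)) = R $$ (i, j)" if "i < m" "j < m" for i j
    using assms(1) adj[of i R j] that by (auto simp: Sigma_w_def)
  have one: "conjugate 1 = (1 :: 'a)"
    by (metis conjugate_dist_mul conjugate_id mult.right_neutral mult.left_neutral)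
  show ?thesis
    using assms(1)
    by (intro eq_matI)
      (auto simp: Sigma_w_def palindromic_pencil_def pencil_def palindromic_mat_def Let_def
        append_rows_def append_cols_def dim adj Q R one c_def z_def one_pCons)
qed

definition mat_image :: "'a :: semiring_0 mat \<Rightarrow> 'a vec set" where
  "mat_image M = (\<lambda>v. M *\<^sub>v v) ` carrier_vec (dim_col M)"

text \<open>In the library, \<open>w \<bullet>c x\<close> conjugates the second argument, so \<open>(M *\<^sub>v y) \<bullet>c x\<close> is the
  form value at \<open>(x, y)\<close> with the conjugate transpose on \<open>x\<close>.\<close>

definition neutral :: "'a :: conjugatable_field mat \<Rightarrow> 'a vec set \<Rightarrow> bool" where
  "neutral M Y \<longleftrightarrow> VectorSpace.subspace class_ring Y (module_vec TYPE('a) (dim_row M)) \<and>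
     (\<forall>x\<in>Y. \<forall>y\<in>Y. (M *\<^sub>v y) \<bullet>c x = 0)"

definition maximally_neutral :: "'a :: conjugatable_field mat \<Rightarrow> 'a vec set \<Rightarrow> bool" where
  "maximally_neutral M Y \<longleftrightarrow> neutral M Y \<and> \<not> (\<exists>W. Y \<subset> W \<and> neutral M W)"

definition lure_solution ::
  "nat \<Rightarrow> 'a :: conjugatable_field mat \<Rightarrow> 'a mat \<Rightarrow> 'a mat \<Rightarrow> 'a mat \<Rightarrow> 'a mat \<Rightarrow>
   'a mat \<Rightarrow> 'a mat \<Rightarrow> 'a mat \<Rightarrow> bool" where
  "lure_solution q A B Q S R X K L \<longleftrightarrow>
    (let n = dim_row A; m = dim_col B in
      X \<in> carrier_mat n n \<and> K \<in> carrier_mat q n \<and> L \<in> carrier_mat q m \<and>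
      mat_adjoint X = X \<and>
      four_block_mat
        (mat_adjoint A * X * A - X + Q) (mat_adjoint A * X * B + S)
        (mat_adjoint B * X * A + mat_adjoint S) (mat_adjoint B * X * B + R) =
      (mat_adjoint K @\<^sub>r mat_adjoint L) * (K @\<^sub>c L))"

end

theory Submission
  imports Defs
begin

text \<open>
  Put \<open>J = [I 0]\<close>, \<open>H = [A B]\<close>, \<open>F = J - H\<close> (all of size \<open>n \<times> (n + m)\<close>), let \<open>\<Pi>\<close> be the weight
  matrix with blocks \<open>Q, S, S\<^sup>*, R\<close>, and for Hermitian \<open>X\<close> let
  \<open>W(X) = H\<^sup>* X H - J\<^sup>* X J + \<Pi>\<close>.  This is the left hand side of the Lur'e equation, so \<open>X\<close> belongs to
  a solution iff \<open>W(X) = D\<^sup>* D\<close> for some \<open>D\<close> with \<open>q\<close> rows, that is, iff \<open>W(X)\<close> is positive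
  semidefinite and of rank at most \<open>q\<close>.  The two parts of the condition on the pencil and the Popov
  function correspond to these two properties of \<open>W(X)\<close>.

  \<^emph>\<open>Rank.\<close>  In block form \<open>\<A>\<^sup>* - \<A>\<close> is \<open>[0 F; -F\<^sup>* 0]\<close> with \<open>F\<close> surjective.  If \<open>F\<close> remains
  surjective on the second components of a neutral subspace, then this subspace consists of vectors
  \<open>(-X F v, v)\<close> for one Hermitian matrix \<open>X\<close>, and it is maximal exactly when \<open>v\<close> is arbitrary
  (\<open>maximally_neutral_graph\<close>, \<open>maximally_neutral_normal_form\<close>).  On such a graph an invertible row
  operation turns \<open>z \<A>\<^sup>* - \<A>\<close> into \<open>[z J - H; (z - 1) W(X)]\<close>.  As \<open>J - H = F\<close> is surjective, the two
  coefficient matrices together have column space \<open>K\<^sup>n \<oplus> im W(X)\<close>, so that a factor \<open>Z\<close> with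
  \<open>n + q\<close> columns exists iff \<open>rk W(X) \<le> q\<close> (\<open>deflating_of_gram\<close>,
  \<open>lure_mat_factorization_of_deflating\<close>).

  \<^emph>\<open>Sign.\<close>  The factor \<open>G\<close> with blocks \<open>(z I - A)\<^sup>-\<^sup>1 B\<close> and \<open>I\<close> satisfies \<open>H G = z J G\<close>, so the
  \<open>X\<close>-dependent terms cancel and \<open>\<Phi> = G\<^sup>~ W(X) G\<close> for every \<open>X\<close> (\<open>popov_lure_mat\<close>).  Hence
  \<open>W(X) = D\<^sup>* D\<close> makes \<open>\<Phi>\<close> semidefinite on the unit circle.  Conversely let \<open>rk W(X) \<le> q = rk \<Phi>\<close> and
  write \<open>W(X) = P C\<close> with inner dimension \<open>q\<close>.  Then \<open>C G\<close> must have full row rank over the rational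
  functions; if \<open>N\<close> is a right inverse of it and \<open>T = N C\<close>, then \<open>W G T = W\<close>, whence
  \<open>W = T\<^sup>~ \<Phi> T\<close>.  Evaluating this identity at one point of the circle that is not a pole shows
  \<open>W(X) \<ge> 0\<close> (\<open>nonneg_lure_mat_of_popov\<close>).

  It remains that a semidefinite matrix which factors through dimension \<open>q\<close> is a Gram matrix with
  \<open>q\<close> rows over the same field, be it real or complex (\<open>nonneg_form_factorization\<close>).
\<close>

section \<open>Rank factorizations\<close>
text \<open>The ring laws for matrices, with equations between dimensions as premises: the simplifier can
  discharge these, while it cannot guess the dimensions that occur only in carrier premises.\<close>

lemma assoc_mult_mat_dim:
  "dim_col A = dim_row B \<Longrightarrow> dim_col B = dim_row C \<Longrightarrow> A * B * C = A * (B * (C :: 'a :: semiring_0 mat))"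
  by (rule assoc_mult_mat[of _ "dim_row A" "dim_col A" _ "dim_col B" _ "dim_col C"]) auto

lemma mult_add_dim:
  fixes A :: "'a :: ring mat"
  shows "dim_row B = dim_row C \<Longrightarrow> dim_col B = dim_col C \<Longrightarrow> dim_col A = dim_row C \<Longrightarrow>
    A * (B + C) = A * B + A * C"
  by (rule mult_add_distrib_mat[of _ "dim_row A" "dim_col A" _ "dim_col C"]) auto

lemma add_mult_dim:
  fixes A :: "'a :: ring mat"
  shows "dim_row A = dim_row B \<Longrightarrow> dim_col A = dim_col B \<Longrightarrow> dim_row C = dim_col B \<Longrightarrow>
    (A + B) * C = A * C + B * C"
  by (rule add_mult_distrib_mat[of _ "dim_row B" "dim_col B" _ _ "dim_col C"]) auto

lemma mult_minus_dim:
  fixes A :: "'a :: ring mat"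
  shows "dim_row B = dim_row C \<Longrightarrow> dim_col B = dim_col C \<Longrightarrow> dim_col A = dim_row C \<Longrightarrow>
    A * (B - C) = A * B - A * C"
  by (rule mult_minus_distrib_mat[of _ "dim_row A" "dim_col A" _ "dim_col C"]) auto

lemma minus_mult_dim:
  fixes A :: "'a :: ring mat"
  shows "dim_row A = dim_row B \<Longrightarrow> dim_col A = dim_col B \<Longrightarrow> dim_row C = dim_col B \<Longrightarrow>
    (A - B) * C = A * C - B * C"
  by (rule minus_mult_distrib_mat[of _ "dim_row B" "dim_col B" _ _ "dim_col C"]) auto

lemma uminus_mult_dim:
  fixes A :: "'a :: comm_ring_1 mat"
  shows "dim_row B = dim_col A \<Longrightarrow> - A * B = - (A * B)" 
  and "dim_row B = dim_col A \<Longrightarrow> A * (- B) = - (A * B)"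
  by (intro eq_matI; auto)+

lemmas mat_dim_simps = assoc_mult_mat_dim mult_add_dim add_mult_dim mult_minus_dim minus_mult_dim
  uminus_mult_dim

lemma factor_through_cols:
  assumes A: "A \<in> carrier_mat nr nc" and P: "P \<in> carrier_mat nr k"
    and ex: "\<And>j. j < nc \<Longrightarrow> \<exists>x \<in> carrier_vec k. col A j = P *\<^sub>v x"
  shows "\<exists>C \<in> carrier_mat k nc. A = P * (C :: 'a :: comm_ring_1 mat)"
proof -
  from ex obtain f where f: "\<And>j. j < nc \<Longrightarrow> f j \<in> carrier_vec k \<and> col A j = P *\<^sub>v f j" by metis
  define C where "C = mat_of_cols k (map f [0..<nc])"
  have C: "C \<in> carrier_mat k nc" unfolding C_def carrier_mat_def by simp
  have "col (P * C) j = col A j" if "j < nc" for j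
    using f[OF that] that col_mult2[OF P C that] by (simp add: C_def)
  then have "A = P * C" using A P C by (intro mat_col_eqI) auto
  then show ?thesis using C by blast
qed

lemma mult_unit_vec:
  fixes A :: "'a :: comm_ring_1 mat"
  assumes "A \<in> carrier_mat nr nc" "j < nc"
  shows "A *\<^sub>v unit_vec nc j = col A j"
  using assms by (intro eq_vecI) auto

text \<open>Padding with zero rows makes the matrix square, and its determinant vanishes.\<close>

lemma wide_mat_kernel:
  fixes C :: "'a :: field mat"
  assumes C: "C \<in> carrier_mat r k" and "r < k"
  shows "\<exists>v \<in> carrier_vec k. v \<noteq> 0\<^sub>v k \<and> C *\<^sub>v v = 0\<^sub>v r"
proof -
  define D where "D = C @\<^sub>r 0\<^sub>m (k - r) k"
  have D: "D \<in> carrier_mat k k"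
    unfolding D_def using carrier_append_rows[OF C, of "0\<^sub>m (k - r) k" "k - r"] \<open>r < k\<close> by simp
  have "row D (k - 1) = 0\<^sub>v k"
    using C \<open>r < k\<close> by (intro eq_vecI) (auto simp: D_def append_rows_def)
  then have "transpose_mat D *\<^sub>v unit_vec k (k - 1) = 0\<^sub>v k"
    using D \<open>r < k\<close> mult_unit_vec[of "transpose_mat D" k k "k - 1"] by simp
  moreover have "unit_vec k (k - 1) \<noteq> 0\<^sub>v k"
    using \<open>r < k\<close> by (auto simp: unit_vec_def zero_vec_def vec_eq_iff)
  ultimately have "det (transpose_mat D) = 0"
    using det_0_iff_vec_prod_zero_field[OF transpose_carrier_mat[THEN iffD2, OF D]] unit_vec_carrier by blast
  then have "det D = 0" using det_transpose[OF D] by simp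
  then obtain v where v: "v \<in> carrier_vec k" "v \<noteq> 0\<^sub>v k" "D *\<^sub>v v = 0\<^sub>v k"
    using det_0_iff_vec_prod_zero_field[OF D] by blast
  have "D *\<^sub>v v = C *\<^sub>v v @\<^sub>v 0\<^sub>m (k - r) k *\<^sub>v v"
    unfolding D_def by (rule mat_mult_append[OF C zero_carrier_mat v(1)])
  then have e: "C *\<^sub>v v @\<^sub>v 0\<^sub>m (k - r) k *\<^sub>v v = 0\<^sub>v k" using v by simp
  have "(C *\<^sub>v v) $ i = 0" if "i < r" for i
    using arg_cong[OF e, of "\<lambda>u. u $ i"] that C \<open>r < k\<close> by simp
  then have "C *\<^sub>v v = 0\<^sub>v r" using C by (intro eq_vecI) auto
  then show ?thesis using v by blast
qed

context vec_space begin

text \<open>\<open>P\<close> consists of a maximal independent set of columns of \<open>A\<close>.  Since \<open>S\<close> selects these columns,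
  everything that annihilates \<open>A\<close> from the left annihilates \<open>P\<close>, and a right inverse of \<open>P\<close> yields one of
  \<open>A\<close>.\<close>

lemma rank_factorization:
  assumes A: "A \<in> carrier_mat n nc"
  shows "\<exists>P \<in> carrier_mat n (rank A). \<exists>C \<in> carrier_mat (rank A) nc.
    \<exists>S \<in> carrier_mat nc (rank A). A = P * C \<and> P = A * S \<and> lin_indpt (set (cols P)) \<and> distinct (cols P)"
proof -
  let ?P = "\<lambda>T. T \<subseteq> set (cols A) \<and> lin_indpt T"
  have "?P {}" using finite_lin_indpt2[of "{}"] by simp
  then obtain U where max: "maximal U ?P"
    using maximal_exists_superset[of "set (cols A)" ?P "{}"] by auto
  then have U: "U \<subseteq> set (cols A)" "lin_indpt U" by (auto simp: maximal_def)
  have cA: "set (cols A) \<subseteq> carrier_vec n" using cols_dim A by blast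
  have finU: "finite U" using U finite_subset by blast
  then obtain us where us: "set us = U" "distinct us" using finite_distinct_list by blast
  have len: "length us = rank A"
    using rank_card_indpt[OF A max] us distinct_card by fastforce
  define P where "P = mat_of_cols n us"
  have P: "P \<in> carrier_mat n (rank A)" unfolding P_def carrier_mat_def by (simp add: len)
  have cP: "cols P = us" unfolding P_def by (rule cols_mat_of_cols) (use us U cA in auto)
  have span: "c \<in> span U" if c: "c \<in> set (cols A)" for c
  proof (rule ccontr)
    assume nc: "c \<notin> span U"
    have "c \<in> carrier_vec n" using c cA by blast
    then have "lin_indpt (U \<union> {c})"
      using lin_dep_iff_in_span[of U c] nc U cA span_mem[of U c] by auto
    then have "?P (U \<union> {c})" using c U by auto
    then have "U = U \<union> {c}" using max unfolding maximal_def by blast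
    then show False using nc U cA span_mem[of U c] by auto
  qed
  have "\<exists>C \<in> carrier_mat (rank A) nc. A = P * C"
  proof (rule factor_through_cols[OF A P])
    fix j assume "j < nc"
    then have "col A j \<in> set (cols A)"
      using A by (metis carrier_matD(2) cols_length cols_nth nth_mem)
    then have "col A j \<in> span U" by (rule span)
    with finU have "\<exists>a. lincomb a U = col A j"
      using finite_in_span[of U "col A j"] order_trans[OF U(1) cA] by (auto simp del: index_col)
    then obtain a where "lincomb a U = col A j" ..
    then have "col A j = P *\<^sub>v vec (rank A) (\<lambda>i. a (col P i))"
      using mat_mult_eq_lincomb[OF P, of a] us cP by simp
    then show "\<exists>x\<in>carrier_vec (rank A). col A j = P *\<^sub>v x" by auto
  qed
  moreover have "\<exists>S \<in> carrier_mat nc (rank A). P = A * S"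
  proof (rule factor_through_cols[OF P A])
    fix k assume k: "k < rank A"
    then have "col P k \<in> set (cols A)" using cP us U len P
      by (metis carrier_matD(2) cols_length cols_nth nth_mem subsetD)
    then obtain j where "j < nc" "col P k = col A j"
      using A by (metis carrier_matD(2) cols_length cols_nth in_set_conv_nth)
    then show "\<exists>x\<in>carrier_vec nc. col P k = A *\<^sub>v x"
      using mult_unit_vec[OF A, of j] by (metis unit_vec_carrier)
  qed
  moreover have "lin_indpt (set (cols P))" "distinct (cols P)" using cP us U by simp_all
  ultimately show ?thesis using P by blast
qed

text \<open>If the rank exceeded \<open>r\<close>, the independent columns of \<open>P C\<close> would be selected by some \<open>S\<close> for which
  \<open>C S\<close> has more columns than rows, and a kernel vector of \<open>C S\<close> would be a linear relation among
  them.\<close>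

lemma rank_le_inner_dim:
  assumes P: "P \<in> carrier_mat n r" and C: "C \<in> carrier_mat r nc"
  shows "rank (P * C) \<le> r"
proof (rule ccontr)
  let ?A = "P * C"
  assume "\<not> ?thesis"
  then have lt: "r < rank ?A" by simp
  have A: "?A \<in> carrier_mat n nc" using P C by simp
  obtain P' S where P': "P' \<in> carrier_mat n (rank ?A)" and S: "S \<in> carrier_mat nc (rank ?A)"
    and eq: "P' = ?A * S" and li: "lin_indpt (set (cols P'))" "distinct (cols P')"
    using rank_factorization[OF A] by blast
  obtain v where v: "v \<in> carrier_vec (rank ?A)" "v \<noteq> 0\<^sub>v (rank ?A)" "(C * S) *\<^sub>v v = 0\<^sub>v r"
    using wide_mat_kernel[OF mult_carrier_mat[OF C S] lt] by blast
  have "P' = P * (C * S)" using eq P C S by simp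
  then have "P' *\<^sub>v v = P *\<^sub>v ((C * S) *\<^sub>v v)" using assoc_mult_mat_vec[OF P mult_carrier_mat[OF C S] v(1)] by simp
  then have "P' *\<^sub>v v = 0\<^sub>v n" using v P by auto
  then show False using lin_depI[OF P' v(1,2) _ li(2)] li(1) by blast
qed

lemma full_row_rank_right_inverse:
  assumes A: "A \<in> carrier_mat n nc" and full: "rank A = n"
  shows "\<exists>N \<in> carrier_mat nc n. A * N = 1\<^sub>m n"
proof -
  obtain P S where P: "P \<in> carrier_mat n n" and S: "S \<in> carrier_mat nc n"
    and eq: "P = A * S" and li: "lin_indpt (set (cols P))" "distinct (cols P)"
    using rank_factorization[OF A] full by metis
  have "det P \<noteq> 0" using lin_indpt_full_rank[OF P li(2,1)] det_rank_iff[OF P] by blast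
  then obtain P' where P': "P' \<in> carrier_mat n n" "P * P' = 1\<^sub>m n"
    using det_non_zero_imp_unit[OF P, of "()"] unfolding Units_def ring_mat_def by auto
  then have "A * (S * P') = 1\<^sub>m n" using eq assoc_mult_mat[OF A S P'(1)] by simp
  then show ?thesis using S P' by (meson mult_carrier_mat)
qed

end

section \<open>Gram factorization of semidefinite matrices\<close>
lemma conjugate_one [simp]: "conjugate 1 = (1 :: 'a :: conjugatable_field)"
  by (metis conjugate_dist_mul conjugate_id mult.right_neutral mult.left_neutral)

lemma conjugate_minus: "conjugate (a - b :: 'a :: conjugatable_field) = conjugate a - conjugate b"
  by (metis ab_group_add_class.ab_diff_conv_add_uminus conjugate_dist_add conjugate_neg)

lemma dim_mat_adjoint [simp]:
  "dim_row (mat_adjoint M) = dim_col M" "dim_col (mat_adjoint M) = dim_row M"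
  by (simp_all add: mat_adjoint_def)

lemma mat_adjoint_carrier [simp, intro]:
  "M \<in> carrier_mat nr nc \<Longrightarrow> mat_adjoint M \<in> carrier_mat nc nr"
  by (rule carrier_matI) auto

lemma index_mat_adjoint [simp]:
  "i < dim_col M \<Longrightarrow> j < dim_row M \<Longrightarrow> mat_adjoint M $$ (i, j) = conjugate (M $$ (j, i))"
  by (simp add: mat_adjoint_def mat_of_rows_index)

lemma mat_adjoint_one [simp]: "mat_adjoint (1\<^sub>m n) = 1\<^sub>m n"
  and mat_adjoint_zero [simp]: "mat_adjoint (0\<^sub>m n k) = 0\<^sub>m k n"
  and mat_adjoint_adjoint [simp]: "mat_adjoint (mat_adjoint M) = M"
  by (intro eq_matI; simp)+

lemma mat_adjoint_add:
  "dim_row A = dim_row B \<Longrightarrow> dim_col A = dim_col B \<Longrightarrow>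
    mat_adjoint (A + B) = mat_adjoint A + mat_adjoint B"
  by (intro eq_matI) (simp_all add: conjugate_dist_add)

lemma mat_adjoint_minus:
  "dim_row A = dim_row B \<Longrightarrow> dim_col A = dim_col B \<Longrightarrow>
    mat_adjoint (A - B) = mat_adjoint A - mat_adjoint B"
  by (intro eq_matI) (simp_all add: conjugate_minus)

lemma mat_adjoint_uminus: "mat_adjoint (- A) = - mat_adjoint A"
  by (intro eq_matI) (simp_all add: conjugate_neg)

lemma mat_adjoint_mult:
  "dim_col A = dim_row B \<Longrightarrow> mat_adjoint (A * B) = mat_adjoint B * mat_adjoint A"
  by (intro eq_matI)
    (simp_all add: scalar_prod_def sum_conjugate conjugate_dist_mul mult.commute)

lemmas mat_adjoint_simps = mat_adjoint_add mat_adjoint_minus mat_adjoint_uminus mat_adjoint_mult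

lemma cscalar_prod_adjoint:
  fixes M :: "'a :: conjugatable_field mat"
  assumes "M \<in> carrier_mat nr nc" "v \<in> carrier_vec nc" "w \<in> carrier_vec nr"
  shows "(M *\<^sub>v v) \<bullet>c w = v \<bullet>c (mat_adjoint M *\<^sub>v w)"
proof -
  have "(M *\<^sub>v v) \<bullet>c w = (\<Sum>i<nr. \<Sum>j<nc. M $$ (i, j) * v $ j * conjugate (w $ i))"
    using assms by (simp add: scalar_prod_def sum_distrib_right atLeast0LessThan)
  also have "\<dots> = (\<Sum>j<nc. \<Sum>i<nr. M $$ (i, j) * v $ j * conjugate (w $ i))"
    by (rule sum.swap)
  also have "\<dots> = v \<bullet>c (mat_adjoint M *\<^sub>v w)"
    using assms by (simp add: scalar_prod_def sum_distrib_left sum_conjugate conjugate_dist_mul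
        atLeast0LessThan mult_ac)
  finally show ?thesis .
qed

lemma adjoint_append_rows_mult:
  fixes D :: "'a :: conjugatable_field mat"
  assumes D: "D \<in> carrier_mat k N" and d: "d \<in> carrier_mat l N"
  shows "mat_adjoint (D @\<^sub>r d) * (D @\<^sub>r d) = mat_adjoint D * D + mat_adjoint d * d"
proof (rule eq_matI)
  fix i j assume "i < dim_row (mat_adjoint D * D + mat_adjoint d * d)"
    "j < dim_col (mat_adjoint D * D + mat_adjoint d * d)"
  then have ij: "i < N" "j < N" using d by auto
  let ?f = "\<lambda>r. conjugate ((D @\<^sub>r d) $$ (r, i)) * (D @\<^sub>r d) $$ (r, j)"
  have "sum ?f {0..<k + l} = sum ?f {0..<k} + sum ?f {k..<k + l}"
    by (simp add: sum.atLeastLessThan_concat)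
  also have "sum ?f {k..<k + l} = (\<Sum>r=0..<l. ?f (r + k))"
    using sum.shift_bounds_nat_ivl[of ?f 0 k l] by (simp add: add.commute)
  finally show "(mat_adjoint (D @\<^sub>r d) * (D @\<^sub>r d)) $$ (i, j) =
      (mat_adjoint D * D + mat_adjoint d * d) $$ (i, j)"
    using D d ij by (simp add: scalar_prod_def append_rows_def)
qed (use D d in \<open>auto simp: append_rows_def\<close>)

lemma to_complex_eq_iff [simp]: "to_complex x = to_complex y \<longleftrightarrow> x = y"
proof -
  interpret field_hom "to_complex :: 'a \<Rightarrow> complex" by (rule field_hom_to_complex)
  show ?thesis by simp
qed

lemma
  fixes x :: "'a :: real_or_complex" and f :: "'i \<Rightarrow> 'a"
  shows to_complex_zero [simp]: "to_complex (0 :: 'a) = 0"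
  and to_complex_sum: "to_complex (sum f I) = (\<Sum>i\<in>I. to_complex (f i))"
  and to_complex_eq_0_iff [simp]: "to_complex x = 0 \<longleftrightarrow> x = 0"
proof -
  interpret field_hom "to_complex :: 'a \<Rightarrow> complex" by (rule field_hom_to_complex)
  show "to_complex (0 :: 'a) = 0" "to_complex (sum f I) = (\<Sum>i\<in>I. to_complex (f i))"
    "to_complex x = 0 \<longleftrightarrow> x = 0"
    by (simp_all add: hom_sum)
qed

lemma ex_to_complex_of_real: "\<exists>b :: 'a :: real_or_complex. to_complex b = complex_of_real t"
proof -
  have "complex_of_real t \<in> range (to_complex :: 'a \<Rightarrow> complex)"
    using range_to_complex[where 'a = 'a] by auto
  then show ?thesis by (metis rangeE)
qed

text \<open>The doubled form value is what polarization with the vectors \<open>x\<close> and \<open>W x\<close> produces.  The factor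
  \<open>2\<close> can be cancelled in \<^typ>\<open>complex\<close>.\<close>

lemma cscalar_prod_self_eq_0:
  fixes u v :: "'a :: real_or_complex vec"
  assumes "u \<bullet>c u + u \<bullet>c u = 0"
  shows "u = 0\<^sub>v (dim_vec u)"
proof -
  let ?c = "to_complex :: 'a \<Rightarrow> complex"
  have "?c (u \<bullet>c u) = of_real (\<Sum>i<dim_vec u. (cmod (?c (u $ i)))\<^sup>2)"
    by (simp add: scalar_prod_def to_complex_sum to_complex_mult to_complex_conjugate
        atLeast0LessThan complex_norm_square del: of_real_power)
  moreover have "?c (u \<bullet>c u) + ?c (u \<bullet>c u) = 0"
    using arg_cong[OF assms, of ?c] by (simp only: to_complex_add to_complex_zero)
  then have "?c (u \<bullet>c u) = 0" by simp
  ultimately have "(\<Sum>i<dim_vec u. (cmod (?c (u $ i)))\<^sup>2) = 0" by (metis of_real_eq_0_iff)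
  then have "\<forall>i<dim_vec u. u $ i = 0" by (simp add: sum_nonneg_eq_0_iff)
  then show ?thesis by (intro eq_vecI) auto
qed

text \<open>Semidefiniteness over the field itself; symmetry is a separate matter, unlike for \<^const>\<open>psd\<close>.\<close>

definition nonneg_form :: "'a :: real_or_complex mat \<Rightarrow> bool" where
  "nonneg_form W \<longleftrightarrow> (\<forall>x \<in> carrier_vec (dim_row W). 0 \<le> to_complex ((W *\<^sub>v x) \<bullet>c x))"

lemma nonneg_form_congruence:
  fixes W T :: "'a :: real_or_complex mat"
  assumes W: "W \<in> carrier_mat N N" "nonneg_form W" and T: "T \<in> carrier_mat N k"
  shows "nonneg_form (mat_adjoint T * W * T)"
  unfolding nonneg_form_def
proof
  fix x :: "'a vec" assume "x \<in> carrier_vec (dim_row (mat_adjoint T * W * T))"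
  then have x: "x \<in> carrier_vec k" using T by simp
  have "((mat_adjoint T * W * T) *\<^sub>v x) \<bullet>c x = (mat_adjoint T *\<^sub>v (W *\<^sub>v (T *\<^sub>v x))) \<bullet>c x"
    using assoc_mult_mat_vec[of "mat_adjoint T * W" k N T k x]
      assoc_mult_mat_vec[of "mat_adjoint T" k N W N "T *\<^sub>v x"] W T x
    by (simp add: mult_carrier_mat[of _ k N])
  also have "\<dots> = (W *\<^sub>v (T *\<^sub>v x)) \<bullet>c (T *\<^sub>v x)"
    using cscalar_prod_adjoint[of "mat_adjoint T" k N "W *\<^sub>v (T *\<^sub>v x)" x] W T x by simp
  finally show "0 \<le> to_complex (((mat_adjoint T * W * T) *\<^sub>v x) \<bullet>c x)"
    using W T x by (auto simp: nonneg_form_def)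
qed

text \<open>Polarization of \<open>x\<close> with \<open>y = W x\<close> gives \<open>2 y\<^sup>* y = 0\<close>.  With this choice of \<open>y\<close> real scalars
  suffice, so the argument covers both fields.\<close>

lemma hermitian_form_eq_0:
  fixes W :: "'a :: real_or_complex mat"
  assumes W: "W \<in> carrier_mat N N" "mat_adjoint W = W"
    and zero: "\<And>x. x \<in> carrier_vec N \<Longrightarrow> (W *\<^sub>v x) \<bullet>c x = 0"
  shows "W = 0\<^sub>m N N"
proof -
  have "W *\<^sub>v x = 0\<^sub>v N" if x: "x \<in> carrier_vec N" for x
  proof -
    define y where "y = W *\<^sub>v x"
    have y: "y \<in> carrier_vec N" using W x by (simp add: y_def)
    have "0 = (W *\<^sub>v (x + y)) \<bullet>c (x + y)" using zero[of "x + y"] x y by simp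
    also have "\<dots> = (W *\<^sub>v x) \<bullet>c x + (W *\<^sub>v x) \<bullet>c y + ((W *\<^sub>v y) \<bullet>c x + (W *\<^sub>v y) \<bullet>c y)"
      using W x y by (simp add: mult_add_distrib_mat_vec[of _ N N] conjugate_add_vec[of _ N]
          add_scalar_prod_distrib[of _ N] scalar_prod_add_distrib[of _ N])
    also have "(W *\<^sub>v y) \<bullet>c x = y \<bullet>c y"
      using cscalar_prod_adjoint[OF W(1) y x] W(2) by (simp add: y_def)
    finally have "y \<bullet>c y + y \<bullet>c y = 0" using zero[OF x] zero[OF y] by (simp add: y_def)
    then show ?thesis using cscalar_prod_self_eq_0[of y] carrier_vecD[OF y] by (simp flip: y_def)
  qed
  then have "col W j = 0\<^sub>v N" if "j < N" for j
    using mult_unit_vec[OF W(1) that] by (metis unit_vec_carrier)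
  then show ?thesis using W by (intro mat_col_eqI) auto
qed

text \<open>A vector on which the form does not vanish is scaled to form value \<open>1\<close>, which needs the square
  root of a positive real number only; these exist in either field.\<close>

lemma ex_form_normalized:
  fixes W :: "'a :: real_or_complex mat"
  assumes W: "W \<in> carrier_mat N N" "mat_adjoint W = W" "nonneg_form W" and "W \<noteq> 0\<^sub>m N N"
  shows "\<exists>X \<in> carrier_mat N 1. mat_adjoint X * (W * X) = 1\<^sub>m 1"
proof -
  obtain x where x: "x \<in> carrier_vec N" "(W *\<^sub>v x) \<bullet>c x \<noteq> 0"
    using hermitian_form_eq_0 assms by blast
  define a where "a = Re (to_complex ((W *\<^sub>v x) \<bullet>c x))"
  have "0 \<le> to_complex ((W *\<^sub>v x) \<bullet>c x)" using W x by (auto simp: nonneg_form_def)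
  then have a: "to_complex ((W *\<^sub>v x) \<bullet>c x) = of_real a" and "a \<ge> 0"
    by (auto simp: a_def less_eq_complex_def complex_eq_iff)
  with x have "a > 0" by (metis less_eq_real_def of_real_0 to_complex_eq_0_iff)
  obtain b :: 'a where b: "to_complex b = of_real (1 / sqrt a)"
    using ex_to_complex_of_real by blast
  have "to_complex (conjugate b * (b * ((W *\<^sub>v x) \<bullet>c x))) = of_real (1 / sqrt a * (1 / sqrt a * a))"
    by (simp only: to_complex_mult to_complex_conjugate a b complex_cnj_complex_of_real of_real_mult)
  also have "1 / sqrt a * (1 / sqrt a * a) = 1" using \<open>a > 0\<close> by (simp add: field_simps)
  finally have n: "conjugate b * (b * ((W *\<^sub>v x) \<bullet>c x)) = 1"
    by (metis of_real_1 to_complex_eq_iff to_complex_one)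
  define X where "X = mat N 1 (\<lambda>(i, j). b * x $ i)"
  have X: "X \<in> carrier_mat N 1" by (simp add: X_def)
  have "col X 0 = b \<cdot>\<^sub>v x" using x by (intro eq_vecI) (auto simp: X_def)
  then have WX: "W * X = mat N 1 (\<lambda>(i, j). b * (W *\<^sub>v x) $ i)"
    using W X x by (intro eq_matI) auto
  have "mat_adjoint X * (W * X) = 1\<^sub>m 1"
  proof (rule eq_matI)
    fix i j assume "i < dim_row (1\<^sub>m 1 :: 'a mat)" "j < dim_col (1\<^sub>m 1 :: 'a mat)"
    then have ij: "i = 0" "j = 0" by auto
    have "(mat_adjoint X * (W * X)) $$ (0, 0) =
        (\<Sum>k<N. conjugate (b * x $ k) * (b * (W *\<^sub>v x) $ k))"
      using X unfolding WX by (simp add: scalar_prod_def atLeast0LessThan) (simp add: X_def)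
    also have "\<dots> = conjugate b * (b * (\<Sum>k<N. (W *\<^sub>v x) $ k * conjugate (x $ k)))"
      by (simp add: sum_distrib_left conjugate_dist_mul mult_ac)
    also have "(\<Sum>k<N. (W *\<^sub>v x) $ k * conjugate (x $ k)) = (W *\<^sub>v x) \<bullet>c x"
      using x by (simp add: scalar_prod_def atLeast0LessThan)
    finally show "(mat_adjoint X * (W * X)) $$ (i, j) = 1\<^sub>m 1 $$ (i, j)"
      using n ij by simp
  qed (use X W in auto)
  then show ?thesis using X by blast
qed

text \<open>Completing the square: for \<open>X\<^sup>* W X = 1\<close> and \<open>d = X\<^sup>* W\<close> the matrix \<open>W - d\<^sup>* d\<close> equals \<open>T\<^sup>* W T\<close> with
  the projection \<open>T = I - X d\<close>, so it is again semidefinite.  It also equals \<open>P E C\<close> with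
  \<open>E = I - (C X) (X\<^sup>* P)\<close>, and \<open>E\<close> is singular because \<open>X\<^sup>* P\<close> annihilates it from the left.  So the inner
  dimension drops by at least one for each row \<open>d\<close> split off.\<close>

lemma nonneg_form_factorization_le:
  fixes W :: "'a :: real_or_complex mat"
  assumes "W \<in> carrier_mat N N" "mat_adjoint W = W" "nonneg_form W"
    and "P \<in> carrier_mat N q" "C \<in> carrier_mat q N" "W = P * C"
  shows "\<exists>k\<le>q. \<exists>D \<in> carrier_mat k N. W = mat_adjoint D * D"
  using assms
proof (induction q arbitrary: W P C rule: less_induct)
  case (less q)
  note W = less.prems(1-3) and P = less.prems(4) and C = less.prems(5) and PC = less.prems(6)
  note [simp] = carrier_matD[OF W(1)] carrier_matD[OF P] carrier_matD[OF C]
  show ?case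
  proof (cases "W = 0\<^sub>m N N")
    case True
    have "W = mat_adjoint (0\<^sub>m 0 N) * 0\<^sub>m 0 N" by (simp add: True)
    then show ?thesis by (metis le0 zero_carrier_mat)
  next
    case False
    obtain X where X: "X \<in> carrier_mat N 1" and n: "mat_adjoint X * (W * X) = 1\<^sub>m 1"
      using ex_form_normalized[OF W False] by blast
    note [simp] = carrier_matD[OF X]
    define d where "d = mat_adjoint X * W"
    have d: "d \<in> carrier_mat 1 N" unfolding d_def by (rule carrier_matI) simp_all
    have d': "mat_adjoint d = W * X" by (simp add: d_def mat_adjoint_mult W(2))
    note [simp] = carrier_matD[OF d]
    define E where "E = 1\<^sub>m q - (C * X) * (mat_adjoint X * P)"
    have E: "E \<in> carrier_mat q q" unfolding E_def by (rule carrier_matI) simp_all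
    define W' where "W' = W - mat_adjoint d * d"
    have W'E: "W' = P * (E * C)"
      by (simp add: W'_def E_def d' mat_dim_simps) (simp add: d_def PC mat_dim_simps)
    define T where "T = 1\<^sub>m N - X * d"
    have T: "T \<in> carrier_mat N N" unfolding T_def by (rule carrier_matI) simp_all
    have dX: "d * X = 1\<^sub>m 1" using n by (simp add: d_def mat_dim_simps)
    have dXd: "d * (X * d) = d" using d dX assoc_mult_mat[OF d X d] by simp
    have TW: "mat_adjoint T * W = W - mat_adjoint d * d"
      using W by (simp add: T_def mat_adjoint_simps mat_dim_simps) (simp add: d_def mat_dim_simps)
    have "W * (X * d) = mat_adjoint d * d" by (simp add: d' mat_dim_simps)
    then have TWT: "mat_adjoint T * W * T = W - mat_adjoint d * d - (mat_adjoint d * d - mat_adjoint d * d)"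
      using W unfolding TW by (simp add: T_def mat_dim_simps dXd)
    \<comment> \<open>The bracket in \<open>TWT\<close> is zero.\<close>
    have "mat_adjoint T * W * T = W'"
      unfolding TWT W'_def using d W by (intro eq_matI) (auto simp del: index_mult_mat(1))
    then have W': "W' \<in> carrier_mat N N" "nonneg_form W'"
      using nonneg_form_congruence[OF W(1,3) T] by (auto simp: W'_def)
    have W'h: "mat_adjoint W' = W'" by (simp add: W'_def mat_adjoint_simps W(2))
    let ?r = "vec_space.rank q E"
    have "?r \<noteq> q"
    proof
      assume "?r = q"
      then obtain E' where E': "E' \<in> carrier_mat q q" "E * E' = 1\<^sub>m q"
        using vec_space.full_row_rank_right_inverse[OF E] by blast
      note [simp] = carrier_matD[OF E'(1)]
      let ?r = "mat_adjoint X * P"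
      have r: "?r \<in> carrier_mat 1 q" by (rule carrier_matI) simp_all
      have "?r * E = ?r - (mat_adjoint X * (W * X)) * ?r"
        using X P by (simp add: E_def PC mat_dim_simps)
      also have "\<dots> = 0\<^sub>m 1 q" using X P unfolding n by (intro eq_matI) auto
      finally have "?r * (E * E') = 0\<^sub>m 1 q"
        using E'(1) assoc_mult_mat[OF r E E'(1)] by simp
      then have "?r = 0\<^sub>m 1 q" unfolding E'(2) right_mult_one_mat[OF r] .
      then have "mat_adjoint X * (W * X) = 0\<^sub>m 1 q * (C * X)"
        using PC assoc_mult_mat_dim[of "mat_adjoint X" P "C * X"] by (simp add: assoc_mult_mat_dim)
      then have "(1\<^sub>m 1 :: 'a mat) = 0\<^sub>m 1 1" using n C X by simp
      then show False by (metis index_one_mat(1) index_zero_mat(1) zero_neq_one less_numeral_extra(1))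
    qed
    then have "?r < q" using vec_space.rank_le_nc[OF E] by simp
    moreover obtain P1 C1 where "P1 \<in> carrier_mat q ?r" "C1 \<in> carrier_mat ?r q" "E = P1 * C1"
      using vec_space.rank_factorization[OF E] by blast
    ultimately obtain k D where k: "k \<le> ?r" and D: "D \<in> carrier_mat k N" "W' = mat_adjoint D * D"
      using less.IH[of ?r W' "P * P1" "C1 * C"] W' W'h P C W'E by (fastforce simp: mat_dim_simps)
    have "W = W' + mat_adjoint d * d" using W d unfolding W'_def by (intro eq_matI) auto
    then have "W = mat_adjoint (D @\<^sub>r d) * (D @\<^sub>r d)"
      by (simp add: adjoint_append_rows_mult[OF D(1) d] D(2))
    moreover have "D @\<^sub>r d \<in> carrier_mat (k + 1) N" using D d by blast
    moreover have "k + 1 \<le> q" using k \<open>?r < q\<close> by simp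
    ultimately show ?thesis by blast
  qed
qed

lemma nonneg_form_factorization:
  fixes W :: "'a :: real_or_complex mat"
  assumes "W \<in> carrier_mat N N" "mat_adjoint W = W" "nonneg_form W"
    and "P \<in> carrier_mat N r" "C \<in> carrier_mat r N" "W = P * C" "r \<le> q"
  shows "\<exists>D \<in> carrier_mat q N. W = mat_adjoint D * D"
proof -
  obtain k D where k: "k \<le> q" and D: "D \<in> carrier_mat k N" "W = mat_adjoint D * D"
    using nonneg_form_factorization_le[OF assms(1-6)] assms(7) by (meson order_trans)
  have "mat_adjoint (D @\<^sub>r 0\<^sub>m (q - k) N) * (D @\<^sub>r 0\<^sub>m (q - k) N) = W"
    using D assms(1) by (simp add: adjoint_append_rows_mult[OF D(1) zero_carrier_mat])
  moreover have "D @\<^sub>r 0\<^sub>m (q - k) N \<in> carrier_mat q N"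
    using carrier_append_rows[OF D(1) zero_carrier_mat, of "q - k"] k by simp
  ultimately show ?thesis by metis
qed

section \<open>Para-conjugation and evaluation of rational functions\<close>
lemma
  fixes p q :: "'a :: real_or_complex poly"
  shows para_conj_poly_add: "para_conj_poly (p + q) = para_conj_poly p + para_conj_poly q"
    and para_conj_poly_one: "para_conj_poly (1 :: 'a poly) = 1"
proof -
  interpret comm_ring_hom "\<lambda>c :: 'a. const_fract (conjugate c)" by (rule comm_ring_hom_const_conj)
  interpret mp: map_poly_comm_ring_hom "\<lambda>c :: 'a. const_fract (conjugate c)" ..
  show "para_conj_poly (p + q) = para_conj_poly p + para_conj_poly q"
    by (simp add: para_conj_poly_def mp.hom_add)
  show "para_conj_poly (1 :: 'a poly) = 1"
    by (simp add: para_conj_poly_def)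
qed

lemma para_conj_poly_pCons:
  "para_conj_poly (pCons a p) = const_fract (conjugate a) + inverse zvar * para_conj_poly p"
  by (simp add: para_conj_poly_def Polynomial.map_poly_pCons)

lemma para_conj_poly_0 [simp]: "para_conj_poly 0 = 0"
  by (simp add: para_conj_poly_eq_0_iff)

lemma para_conj_to_fract: "para_conj (to_fract p) = para_conj_poly p"
  by (simp add: to_fract_def para_conj_Fract para_conj_poly_one)

text \<open>Additivity and multiplicativity of para-conjugation make the para-adjoint reverse products of
  matrices.\<close>

lemma field_hom_para_conj: "field_hom (para_conj :: 'a :: real_or_complex poly fract \<Rightarrow> _)"
proof
  show z: "para_conj 0 = (0 :: 'a poly fract)"
    using para_conj_to_fract[of 0] by simp
  show "para_conj 1 = (1 :: 'a poly fract)"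
    using para_conj_to_fract[of 1] by (simp add: para_conj_poly_one)
  fix x y :: "'a poly fract"
  obtain p d q e where "x = Fract p d" "d \<noteq> 0" "y = Fract q e" "e \<noteq> 0"
    by (metis Fract_cases)
  then show "para_conj (x + y) = para_conj x + para_conj y"
    and "para_conj (x * y) = para_conj x * para_conj y"
    by (simp_all add: para_conj_Fract para_conj_poly_add para_conj_poly_mult para_conj_poly_eq_0_iff
        divide_simps)
qed

interpretation para_conj: field_hom "para_conj :: 'a :: real_or_complex poly fract \<Rightarrow> _"
  by (rule field_hom_para_conj)

lemma para_conj_zvar: "para_conj zvar = inverse zvar"
  by (simp add: zvar_def para_conj_to_fract para_conj_poly_pCons) (simp add: const_fract_def one_pCons[symmetric] zvar_def)

lemma para_conj_const_fract: "para_conj (const_fract c) = const_fract (conjugate c)"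
  unfolding const_fract_def[of c] para_conj_to_fract by (simp add: para_conj_poly_pCons)

interpretation const_fract: field_hom "const_fract :: 'a :: field \<Rightarrow> 'a poly fract"
  by standard (simp_all add: const_fract_def flip: to_fract_add to_fract_mult one_pCons)

lemma dim_para_adjoint [simp]:
  "dim_row (para_adjoint G) = dim_col G" "dim_col (para_adjoint G) = dim_row G"
  by (simp_all add: para_adjoint_def)

lemma index_para_adjoint [simp]:
  "i < dim_col G \<Longrightarrow> j < dim_row G \<Longrightarrow> para_adjoint G $$ (i, j) = para_conj (G $$ (j, i))"
  by (simp add: para_adjoint_def)

lemma para_adjoint_mult:
  "dim_col A = dim_row B \<Longrightarrow> para_adjoint (A * B) = para_adjoint B * para_adjoint A"
  by (intro eq_matI) (simp_all add: scalar_prod_def para_conj.hom_sum para_conj.hom_mult mult.commute)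

lemma para_adjoint_const:
  "para_adjoint (map_mat const_fract M) = map_mat const_fract (mat_adjoint M)"
  by (intro eq_matI) (simp_all add: para_conj_const_fract)

lemma para_adjoint_smult: "para_adjoint (c \<cdot>\<^sub>m G) = para_conj c \<cdot>\<^sub>m para_adjoint G"
  by (intro eq_matI) (simp_all add: para_conj.hom_mult)

lemma const_fract_mat_mult:
  "dim_col A = dim_row B \<Longrightarrow>
    map_mat const_fract (A * B) = map_mat const_fract A * map_mat const_fract B"
  by (rule const_fract.mat_hom_mult[of _ "dim_row A" "dim_row B" _ "dim_col B"]) auto

text \<open>The rational functions without a pole at \<open>w\<close>.  They form a local ring, and on it
  \<^term>\<open>rat_eval w\<close> is a homomorphism; elsewhere its value is unspecified.\<close>

definition regular_at :: "complex \<Rightarrow> 'a :: real_or_complex poly fract \<Rightarrow> bool" where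
  "regular_at w r \<longleftrightarrow> (\<exists>p d. r = Fract p d \<and> poly (map_poly to_complex d) w \<noteq> 0)"

definition eval_poly_at :: "complex \<Rightarrow> 'a :: real_or_complex poly \<Rightarrow> complex" where
  "eval_poly_at w p = poly (map_poly to_complex p) w"

lemma comm_ring_hom_eval_poly_at:
  "comm_ring_hom (eval_poly_at w :: 'a :: real_or_complex poly \<Rightarrow> complex)"
proof -
  interpret field_hom "to_complex :: 'a \<Rightarrow> complex" by (rule field_hom_to_complex)
  interpret mp: map_poly_comm_ring_hom "to_complex :: 'a \<Rightarrow> complex" ..
  show ?thesis by standard (simp_all add: eval_poly_at_def mp.hom_add mp.hom_mult)
qed

interpretation eval_poly_at: comm_ring_hom "eval_poly_at w :: 'a :: real_or_complex poly \<Rightarrow> complex"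
  by (rule comm_ring_hom_eval_poly_at)

lemma eval_poly_at_pCons: "eval_poly_at w (pCons a p) = to_complex a + w * eval_poly_at w p"
  by (simp add: eval_poly_at_def Polynomial.map_poly_pCons)

lemma regular_at_Fract: "eval_poly_at w d \<noteq> 0 \<Longrightarrow> regular_at w (Fract p d)"
  by (auto simp: regular_at_def eval_poly_at_def)

lemma eval_Fract: "eval_poly_at w d \<noteq> 0 \<Longrightarrow> rat_eval w (Fract p d) = eval_poly_at w p / eval_poly_at w d"
  by (simp add: eval_poly_at_def rat_eval_Fract)

lemma regular_atE:
  assumes "regular_at w r"
  obtains p d where "r = Fract p d" "d \<noteq> 0" "eval_poly_at w d \<noteq> 0"
    "rat_eval w r = eval_poly_at w p / eval_poly_at w d"
proof -
  from assms obtain p d where pd: "r = Fract p d" "eval_poly_at w d \<noteq> 0"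
    by (auto simp: regular_at_def eval_poly_at_def)
  then have "d \<noteq> 0" by auto
  with pd that show thesis by (simp add: eval_Fract)
qed

lemma
  assumes "regular_at w r" "regular_at w s"
  shows regular_at_add: "regular_at w (r + s)"
    and rat_eval_add: "rat_eval w (r + s) = rat_eval w r + rat_eval w s"
    and regular_at_mult: "regular_at w (r * s)"
    and rat_eval_mult: "rat_eval w (r * s) = rat_eval w r * rat_eval w s"
proof -
  obtain p d where pd: "r = Fract p d" "d \<noteq> 0" "eval_poly_at w d \<noteq> 0"
    using assms(1) by (rule regular_atE)
  obtain q e where qe: "s = Fract q e" "e \<noteq> 0" "eval_poly_at w e \<noteq> 0"
    using assms(2) by (rule regular_atE)
  have de: "eval_poly_at w (d * e) \<noteq> 0" using pd qe by (simp add: eval_poly_at.hom_mult)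
  have s: "r + s = Fract (p * e + q * d) (d * e)" and m: "r * s = Fract (p * q) (d * e)"
    using pd qe by simp_all
  show "regular_at w (r + s)" "regular_at w (r * s)"
    unfolding s m by (rule regular_at_Fract[OF de])+
  show "rat_eval w (r + s) = rat_eval w r + rat_eval w s"
    unfolding s eval_Fract[OF de] unfolding pd(1) qe(1) eval_Fract[OF pd(3)] eval_Fract[OF qe(3)]
    using pd(3) qe(3) by (simp add: eval_poly_at.hom_add eval_poly_at.hom_mult field_simps)
  show "rat_eval w (r * s) = rat_eval w r * rat_eval w s"
    unfolding m eval_Fract[OF de] unfolding pd(1) qe(1) eval_Fract[OF pd(3)] eval_Fract[OF qe(3)]
    by (simp add: eval_poly_at.hom_mult)
qed

lemma
  assumes "regular_at w r" "rat_eval w r \<noteq> 0"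
  shows regular_at_inverse: "regular_at w (inverse r)"
    and rat_eval_inverse: "rat_eval w (inverse r) = inverse (rat_eval w r)"
proof -
  obtain p d where pd: "r = Fract p d" "d \<noteq> 0" "eval_poly_at w d \<noteq> 0"
    "rat_eval w r = eval_poly_at w p / eval_poly_at w d"
    using assms(1) by (rule regular_atE)
  then have p: "eval_poly_at w p \<noteq> 0" using assms(2) by auto
  have "inverse r = Fract d p" by (simp add: pd(1))
  then show "regular_at w (inverse r)" "rat_eval w (inverse r) = inverse (rat_eval w r)"
    using regular_at_Fract[OF p] eval_Fract[OF p] pd(4) by simp_all
qed

lemma
  shows regular_at_to_fract: "regular_at w (to_fract p)"
    and rat_eval_to_fract: "rat_eval w (to_fract p) = eval_poly_at w p"
  using regular_at_Fract[of w 1 p] eval_Fract[of w 1 p] by (simp_all add: to_fract_def)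

lemma
  shows regular_at_const: "regular_at w (const_fract c)"
    and rat_eval_const: "rat_eval w (const_fract c) = to_complex c"
    and regular_at_zvar: "regular_at w zvar"
    and rat_eval_zvar: "rat_eval w (zvar :: 'a :: real_or_complex poly fract) = w"
  by (simp_all add: const_fract_def zvar_def regular_at_to_fract rat_eval_to_fract
      eval_poly_at_pCons to_complex_one)

lemma
  assumes "\<And>i. i \<in> I \<Longrightarrow> regular_at w (f i)"
  shows regular_at_sum: "regular_at w (sum f I)"
    and rat_eval_sum: "rat_eval w (sum f I) = (\<Sum>i\<in>I. rat_eval w (f i))"
proof -
  have "regular_at w (sum f I) \<and> rat_eval w (sum f I) = (\<Sum>i\<in>I. rat_eval w (f i))"
    using assms
  proof (induction I rule: infinite_finite_induct)
    case (insert i I)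
    then show ?case by (simp add: regular_at_add rat_eval_add)
  qed (use regular_at_to_fract[of w 0] rat_eval_to_fract[of w 0] in simp_all)
  then show "regular_at w (sum f I)" "rat_eval w (sum f I) = (\<Sum>i\<in>I. rat_eval w (f i))"
    by blast+
qed

text \<open>Finiteness of the set of poles is what provides a generic point of the unit circle later on.\<close>

lemma finite_not_regular_at: "finite {w. \<not> regular_at w r}"
proof -
  obtain p d where pd: "r = Fract p d" "d \<noteq> 0" by (rule Fract_cases)
  have "map_poly to_complex d \<noteq> 0"
    using pd(2) by (simp add: poly_eq_iff coeff_map_poly)
  then have "finite {w. poly (map_poly to_complex d) w = 0}" by (rule poly_roots_finite)
  then show ?thesis
    by (rule rev_finite_subset) (auto simp: pd regular_at_def)
qed

text \<open>On the unit circle the inverse of \<open>w\<close> is its conjugate, so substituting \<open>z\<^sup>-\<^sup>1\<close> and conjugating the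
  coefficients amounts to conjugating the value.\<close>

lemma para_conj_poly_on_circle:
  fixes p :: "'a :: real_or_complex poly"
  assumes w: "w * cnj w = 1"
  shows "regular_at w (para_conj_poly p) \<and> rat_eval w (para_conj_poly p) = cnj (eval_poly_at w p)"
proof (induction p)
  case 0
  then show ?case using regular_at_to_fract[of w 0] rat_eval_to_fract[of w 0] by simp
next
  case (pCons a p)
  have "w \<noteq> 0" and iw: "inverse w = cnj w" using w inverse_unique[of w] by auto
  then have z: "regular_at w (inverse zvar :: 'a poly fract)" "rat_eval w (inverse zvar :: 'a poly fract) = cnj w"
    by (simp_all add: regular_at_inverse rat_eval_inverse regular_at_zvar rat_eval_zvar)
  show ?case
    using pCons z by (simp add: para_conj_poly_pCons regular_at_add rat_eval_add regular_at_mult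
        rat_eval_mult regular_at_const rat_eval_const eval_poly_at_pCons to_complex_conjugate)
qed

lemma para_conj_on_circle:
  assumes w: "w * cnj w = 1" and r: "regular_at w r"
  shows "regular_at w (para_conj r)" "rat_eval w (para_conj r) = cnj (rat_eval w r)"
proof -
  obtain p d where pd: "r = Fract p d" "d \<noteq> 0" "eval_poly_at w d \<noteq> 0"
    "rat_eval w r = eval_poly_at w p / eval_poly_at w d"
    using r by (rule regular_atE)
  have "para_conj r = para_conj_poly p * inverse (para_conj_poly d)"
    by (simp add: pd(1,2) para_conj_Fract divide_inverse)
  then show "regular_at w (para_conj r)" "rat_eval w (para_conj r) = cnj (rat_eval w r)"
    using para_conj_poly_on_circle[OF w, of p] para_conj_poly_on_circle[OF w, of d] pd(3)
    by (simp_all add: regular_at_mult rat_eval_mult regular_at_inverse rat_eval_inverse pd(4)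
        divide_inverse)
qed

definition regular_mat :: "complex \<Rightarrow> 'a :: real_or_complex poly fract mat \<Rightarrow> bool" where
  "regular_mat w M \<longleftrightarrow> (\<forall>i<dim_row M. \<forall>j<dim_col M. regular_at w (M $$ (i, j)))"

lemma regular_mat_const [simp]: "regular_mat w (map_mat const_fract M)"
  by (simp add: regular_mat_def regular_at_const)

lemma rat_eval_mat_const: "map_mat (rat_eval w) (map_mat const_fract M) = map_mat to_complex M"
  by (intro eq_matI) (simp_all add: rat_eval_const)

lemma
  assumes "regular_mat w M" "regular_mat w N" "dim_col M = dim_row N"
  shows regular_mat_mult: "regular_mat w (M * N)"
    and rat_eval_mat_mult: "map_mat (rat_eval w) (M * N) = map_mat (rat_eval w) M * map_mat (rat_eval w) N"
proof -
  have r: "regular_at w (M $$ (i, k) * N $$ (k, j))" if "i < dim_row M" "k < dim_row N" "j < dim_col N" for i j k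
    using that assms by (auto simp: regular_mat_def intro!: regular_at_mult)
  show "regular_mat w (M * N)"
    using r assms(3) by (auto simp: regular_mat_def scalar_prod_def intro!: regular_at_sum)
  show "map_mat (rat_eval w) (M * N) = map_mat (rat_eval w) M * map_mat (rat_eval w) N"
  proof (rule eq_matI)
    fix i j assume "i < dim_row (map_mat (rat_eval w) M * map_mat (rat_eval w) N)"
      "j < dim_col (map_mat (rat_eval w) M * map_mat (rat_eval w) N)"
    then have ij: "i < dim_row M" "j < dim_col N" by simp_all
    have "rat_eval w (\<Sum>k = 0..<dim_row N. M $$ (i, k) * N $$ (k, j)) =
        (\<Sum>k = 0..<dim_row N. rat_eval w (M $$ (i, k) * N $$ (k, j)))"
      by (rule rat_eval_sum) (use r ij in auto)
    also have "\<dots> = (\<Sum>k = 0..<dim_row N. rat_eval w (M $$ (i, k)) * rat_eval w (N $$ (k, j)))"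
      by (intro sum.cong refl rat_eval_mult) (use assms ij in \<open>auto simp: regular_mat_def\<close>)
    finally show "map_mat (rat_eval w) (M * N) $$ (i, j) =
        (map_mat (rat_eval w) M * map_mat (rat_eval w) N) $$ (i, j)"
      using ij assms(3) by (simp add: scalar_prod_def)
  qed auto
qed

lemma
  assumes "w * cnj w = 1" "regular_mat w M"
  shows regular_mat_para_adjoint: "regular_mat w (para_adjoint M)"
    and rat_eval_mat_para_adjoint:
      "map_mat (rat_eval w) (para_adjoint M) = mat_adjoint (map_mat (rat_eval w) M)"
  using assms
  by (auto simp: regular_mat_def para_conj_on_circle intro!: eq_matI)

lemma finite_not_regular_mat: "finite {w. \<not> regular_mat w M}"
proof -
  have "{w. \<not> regular_mat w M} =
      (\<Union>i\<in>{..<dim_row M}. \<Union>j\<in>{..<dim_col M}. {w. \<not> regular_at w (M $$ (i, j))})"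
    by (auto simp: regular_mat_def)
  then show ?thesis by (simp add: finite_not_regular_at)
qed

section \<open>The Lur'e matrix and the Popov function\<close>
lemma dim_append_cols [simp]:
  "dim_row (A @\<^sub>c B) = dim_row A" "dim_col (A @\<^sub>c B) = dim_col A + dim_col B"
  by (simp_all add: append_cols_def)

lemma dim_append_rows [simp]:
  "dim_row (A @\<^sub>r B) = dim_row A + dim_row B" "dim_col (A @\<^sub>r B) = dim_col A"
  by (simp_all add: append_rows_def)

lemma append_cols_carrier [intro]:
  "A \<in> carrier_mat k a \<Longrightarrow> B \<in> carrier_mat k b \<Longrightarrow> A @\<^sub>c B \<in> carrier_mat k (a + b)"
  by (rule carrier_matI) auto

lemma index_append_cols [simp]:
  "i < dim_row A \<Longrightarrow> j < dim_col A + dim_col B \<Longrightarrow>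
    (A @\<^sub>c B) $$ (i, j) = (if j < dim_col A then A $$ (i, j) else B $$ (i, j - dim_col A))"
  by (simp add: append_cols_def)

lemma index_append_rows [simp]:
  "i < dim_row A + dim_row B \<Longrightarrow> j < dim_col A \<Longrightarrow>
    (A @\<^sub>r B) $$ (i, j) = (if i < dim_row A then A $$ (i, j) else B $$ (i - dim_row A, j))"
  by (simp add: append_rows_def)

lemma append_cols_mult_append_rows:
  fixes A :: "'a :: comm_ring_1 mat"
  assumes "A \<in> carrier_mat r k" "B \<in> carrier_mat r l" "C \<in> carrier_mat k c" "D \<in> carrier_mat l c"
  shows "(A @\<^sub>c B) * (C @\<^sub>r D) = A * C + B * D"
proof -
  have "(A @\<^sub>c B) * (C @\<^sub>r D) =
      four_block_mat A B (0\<^sub>m 0 k) (0\<^sub>m 0 l) * four_block_mat C (0\<^sub>m k 0) D (0\<^sub>m l 0)"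
    using assms by (simp add: append_cols_def append_rows_def)
  also have "\<dots> = four_block_mat (A * C + B * D) (A * 0\<^sub>m k 0 + B * 0\<^sub>m l 0)
      (0\<^sub>m 0 k * C + 0\<^sub>m 0 l * D) (0\<^sub>m 0 k * 0\<^sub>m k 0 + 0\<^sub>m 0 l * 0\<^sub>m l 0)"
    by (rule mult_four_block_mat) (use assms in auto)
  also have "\<dots> = A * C + B * D" using assms by (intro eq_matI) auto
  finally show ?thesis .
qed

lemma append_rows_mult_append_cols:
  fixes A :: "'a :: comm_ring_1 mat"
  assumes "A \<in> carrier_mat r k" "B \<in> carrier_mat s k" "C \<in> carrier_mat k c" "D \<in> carrier_mat k d"
  shows "(A @\<^sub>r B) * (C @\<^sub>c D) = four_block_mat (A * C) (A * D) (B * C) (B * D)"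
proof -
  have "(A @\<^sub>r B) * (C @\<^sub>c D) =
      four_block_mat A (0\<^sub>m r 0) B (0\<^sub>m s 0) * four_block_mat C D (0\<^sub>m 0 c) (0\<^sub>m 0 d)"
    using assms by (simp add: append_cols_def append_rows_def)
  also have "\<dots> = four_block_mat (A * C + 0\<^sub>m r 0 * 0\<^sub>m 0 c) (A * D + 0\<^sub>m r 0 * 0\<^sub>m 0 d)
      (B * C + 0\<^sub>m s 0 * 0\<^sub>m 0 c) (B * D + 0\<^sub>m s 0 * 0\<^sub>m 0 d)"
    by (rule mult_four_block_mat) (use assms in auto)
  also have "\<dots> = four_block_mat (A * C) (A * D) (B * C) (B * D)"
    using assms by (simp add: right_add_zero_mat)
  finally show ?thesis .
qed

lemma four_block_mult_append_rows:
  fixes A :: "'a :: comm_ring_1 mat"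
  assumes "A \<in> carrier_mat r k" "B \<in> carrier_mat r l" "C \<in> carrier_mat s k" "D \<in> carrier_mat s l"
    "P \<in> carrier_mat k c" "Q \<in> carrier_mat l c"
  shows "four_block_mat A B C D * (P @\<^sub>r Q) = (A * P + B * Q) @\<^sub>r (C * P + D * Q)"
proof -
  have "four_block_mat A B C D * (P @\<^sub>r Q) = four_block_mat A B C D * four_block_mat P (0\<^sub>m k 0) Q (0\<^sub>m l 0)"
    using assms by (simp add: append_rows_def)
  also have "\<dots> = four_block_mat (A * P + B * Q) (A * 0\<^sub>m k 0 + B * 0\<^sub>m l 0)
      (C * P + D * Q) (C * 0\<^sub>m k 0 + D * 0\<^sub>m l 0)"
    by (rule mult_four_block_mat) (use assms in auto)
  also have "\<dots> = (A * P + B * Q) @\<^sub>r (C * P + D * Q)"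
    using assms by (intro eq_matI) auto
  finally show ?thesis .
qed

lemma mult_append_cols:
  fixes X :: "'a :: comm_ring_1 mat"
  assumes "X \<in> carrier_mat r k" "C \<in> carrier_mat k c" "D \<in> carrier_mat k d"
  shows "X * (C @\<^sub>c D) = X * C @\<^sub>c X * D"
proof (rule eq_matI)
  fix i j assume "i < dim_row (X * C @\<^sub>c X * D)" "j < dim_col (X * C @\<^sub>c X * D)"
  then have ij: "i < r" "j < c + d" using assms by auto
  have "col (C @\<^sub>c D) j = (if j < c then col C j else col D (j - c))"
    using assms ij by (intro eq_vecI) auto
  then show "(X * (C @\<^sub>c D)) $$ (i, j) = (X * C @\<^sub>c X * D) $$ (i, j)"
    using assms ij by auto
qed (use assms in auto)

lemma append_rows_mult:
  fixes X :: "'a :: comm_ring_1 mat"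
  assumes "C \<in> carrier_mat c k" "D \<in> carrier_mat d k" "X \<in> carrier_mat k l"
  shows "(C @\<^sub>r D) * X = C * X @\<^sub>r D * X"
proof (rule eq_matI)
  fix i j assume "i < dim_row (C * X @\<^sub>r D * X)" "j < dim_col (C * X @\<^sub>r D * X)"
  then have ij: "i < c + d" "j < l" using assms by auto
  have "row (C @\<^sub>r D) i = (if i < c then row C i else row D (i - c))"
    using assms ij by (intro eq_vecI) auto
  then show "((C @\<^sub>r D) * X) $$ (i, j) = (C * X @\<^sub>r D * X) $$ (i, j)"
    using assms ij by auto
qed (use assms in auto)

lemma mat_adjoint_append_cols:
  "dim_row A = dim_row B \<Longrightarrow> mat_adjoint (A @\<^sub>c B) = mat_adjoint A @\<^sub>r mat_adjoint B"
  by (intro eq_matI) auto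

lemma mat_adjoint_append_rows:
  "dim_col A = dim_col B \<Longrightarrow> mat_adjoint (A @\<^sub>r B) = mat_adjoint A @\<^sub>c mat_adjoint B"
  by (intro eq_matI) auto

lemma map_mat_append_cols:
  "dim_row A = dim_row B \<Longrightarrow> map_mat f (A @\<^sub>c B) = map_mat f A @\<^sub>c map_mat f B"
  by (intro eq_matI) auto

text \<open>The projection \<open>[I 0]\<close> of the pair (state, input) to the state.\<close>

definition state_proj :: "nat \<Rightarrow> nat \<Rightarrow> 'a :: {zero,one} mat" where
  "state_proj n m = 1\<^sub>m n @\<^sub>c 0\<^sub>m n m"

definition weight_mat :: "'a :: conjugatable_field mat \<Rightarrow> 'a mat \<Rightarrow> 'a mat \<Rightarrow> 'a mat" where
  "weight_mat Q S R = four_block_mat Q S (mat_adjoint S) R"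

text \<open>The left hand side of the Lur'e equation, written as the weight matrix plus a difference of two
  congruences of \<open>X\<close>.  This form, and not the four blocks, is the one in which both the Popov function and the pencil can be compared
  with it.\<close>

definition lure_mat ::
  "'a :: conjugatable_field mat \<Rightarrow> 'a mat \<Rightarrow> 'a mat \<Rightarrow> 'a mat \<Rightarrow> 'a mat \<Rightarrow> 'a mat \<Rightarrow> 'a mat" where
  "lure_mat A B Q S R X =
    (let H = A @\<^sub>c B; J = state_proj (dim_row A) (dim_col B)
     in mat_adjoint H * (X * H) - mat_adjoint J * (X * J) + weight_mat Q S R)"

definition popov_factor :: "'a :: field mat \<Rightarrow> 'a mat \<Rightarrow> 'a poly fract mat" where
  "popov_factor A B =
    (the (mat_inverse (zvar \<cdot>\<^sub>m 1\<^sub>m (dim_row A) - map_mat const_fract A)) * map_mat const_fract B)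
      @\<^sub>r 1\<^sub>m (dim_col B)"

lemma add_eq_of_minus_eq_mat:
  fixes U V C :: "'a :: ab_group_add mat"
  assumes "U - V = C" "U \<in> carrier_mat r c" "V \<in> carrier_mat r c"
  shows "V + C = U"
  using assms(2,3) unfolding assms(1)[symmetric] by (intro eq_matI) auto

text \<open>The block names of the introduction are local abbreviations in this locale; \<open>weight_mat Q S R\<close> is
  abbreviated as \<open>Qh\<close>, and \<open>cst\<close> embeds constant matrices into those of rational functions.\<close>

locale lure_data =
  fixes A B Q S R :: "'a :: real_or_complex mat" and n m :: nat
  assumes data: "(A, B, Q, S, R) \<in> Sigma_w m n"
begin

lemma carriers:
  "A \<in> carrier_mat n n" "B \<in> carrier_mat n m" "Q \<in> carrier_mat n n" "S \<in> carrier_mat n m"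
  "R \<in> carrier_mat m m" "mat_adjoint Q = Q" "mat_adjoint R = R"
  using data by (auto simp: Sigma_w_def)

lemma dims [simp]:
  "dim_row A = n" "dim_col A = n" "dim_row B = n" "dim_col B = m" "dim_row Q = n" "dim_col Q = n"
  "dim_row S = n" "dim_col S = m" "dim_row R = m" "dim_col R = m"
  using carriers by auto

abbreviation "H \<equiv> A @\<^sub>c B"
abbreviation "J \<equiv> (state_proj n m :: 'a mat)"
abbreviation "Qh \<equiv> weight_mat Q S R"
abbreviation "W \<equiv> lure_mat A B Q S R"
abbreviation "\<Phi> \<equiv> popov A B Q S R"
abbreviation "G \<equiv> popov_factor A B"
abbreviation "cst \<equiv> map_mat (const_fract :: 'a \<Rightarrow> 'a poly fract)"

lemma dims_state_proj [simp]: "dim_row (state_proj n m) = n" "dim_col (state_proj n m) = n + m"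
  by (simp_all add: state_proj_def)

lemma dims_weight [simp]: "dim_row Qh = n + m" "dim_col Qh = n + m"
  by (simp_all add: weight_mat_def)

lemma adjoint_weight [simp]: "mat_adjoint Qh = Qh"
proof -
  have "conjugate (Q $$ (j, i)) = Q $$ (i, j)" if "i < n" "j < n" for i j
    using index_mat_adjoint[of i Q j] that carriers by simp
  moreover have "conjugate (R $$ (j, i)) = R $$ (i, j)" if "i < m" "j < m" for i j
    using index_mat_adjoint[of i R j] that carriers by simp
  ultimately show ?thesis by (intro eq_matI) (auto simp: weight_mat_def)
qed

lemma lure_mat_eq:
  "W X = mat_adjoint H * (X * H) - mat_adjoint J * (X * J) + Qh"
  by (simp add: lure_mat_def Let_def)

lemma dims_lure_mat [simp]: "dim_row (W X) = n + m" "dim_col (W X) = n + m"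
  by (simp_all add: lure_mat_eq)

lemma lure_mat_hermitian:
  assumes "X \<in> carrier_mat n n" "mat_adjoint X = X"
  shows "mat_adjoint (W X) = W X"
  using assms by (simp add: lure_mat_eq mat_adjoint_simps assoc_mult_mat_dim)

lemma lure_mat_blocks:
  assumes X: "X \<in> carrier_mat n n"
  shows "W X = four_block_mat
        (mat_adjoint A * X * A - X + Q) (mat_adjoint A * X * B + S)
        (mat_adjoint B * X * A + mat_adjoint S) (mat_adjoint B * X * B + R)"
proof -
  note [simp] = carrier_matD[OF X]
  have "mat_adjoint H * (X * H) = (mat_adjoint A @\<^sub>r mat_adjoint B) * (X * A @\<^sub>c X * B)"
    using mult_append_cols[OF X carriers(1,2)] by (simp add: mat_adjoint_append_cols)
  also have "\<dots> = four_block_mat (mat_adjoint A * X * A) (mat_adjoint A * X * B)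
      (mat_adjoint B * X * A) (mat_adjoint B * X * B)"
    using append_rows_mult_append_cols[of "mat_adjoint A" n n "mat_adjoint B" m "X * A" n "X * B" m]
      carriers X by (simp add: assoc_mult_mat_dim)
  finally have H: "mat_adjoint H * (X * H) = \<dots>" .
  have "mat_adjoint J * (X * J) = (1\<^sub>m n @\<^sub>r 0\<^sub>m m n) * (X * 1\<^sub>m n @\<^sub>c X * 0\<^sub>m n m)"
    using mult_append_cols[OF X one_carrier_mat zero_carrier_mat]
    by (simp add: mat_adjoint_append_cols state_proj_def)
  also have "\<dots> = four_block_mat X (0\<^sub>m n m) (0\<^sub>m m n) (0\<^sub>m m m)"
    using append_rows_mult_append_cols[OF one_carrier_mat zero_carrier_mat X zero_carrier_mat, of m m] X
    by simp
  finally have J: "mat_adjoint J * (X * J) = \<dots>" .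
  show ?thesis
    unfolding lure_mat_eq H J weight_mat_def
    by (intro eq_matI) (auto simp del: index_mult_mat(1))
qed

lemma lure_solution_iff:
  "lure_solution q A B Q S R X K L \<longleftrightarrow>
    X \<in> carrier_mat n n \<and> K \<in> carrier_mat q n \<and> L \<in> carrier_mat q m \<and> mat_adjoint X = X \<and>
    W X = mat_adjoint (K @\<^sub>c L) * (K @\<^sub>c L)"
  by (auto simp: lure_solution_def Let_def lure_mat_blocks mat_adjoint_append_cols)

lemma dims_popov_factor [simp]: "dim_row G = n + m" "dim_col G = m"
  using resolvent_inverse(1)[OF carriers(1)] by (simp_all add: popov_factor_def)

lemma popov_eq: "\<Phi> = para_adjoint G * (cst Qh * G)"
proof -
  have "\<Phi> = para_adjoint G * cst Qh * G"
    by (simp add: popov_def popov_factor_def weight_mat_def Let_def)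
  then show ?thesis by (simp add: assoc_mult_mat_dim)
qed

lemma dims_popov [simp]: "dim_row \<Phi> = m" "dim_col \<Phi> = m"
  by (simp_all add: popov_eq)

text \<open>This is \<open>(z I - A) (z I - A)\<^sup>-\<^sup>1 B = B\<close>, rewritten as \<open>z (z I - A)\<^sup>-\<^sup>1 B = A (z I - A)\<^sup>-\<^sup>1 B + B\<close>.\<close>

lemma popov_factor_shift: "cst H * G = zvar \<cdot>\<^sub>m (cst J * G)"
proof -
  let ?M = "zvar \<cdot>\<^sub>m 1\<^sub>m n - cst A"
  let ?T = "the (mat_inverse ?M)"
  note T = resolvent_inverse[OF carriers(1)]
  have cA: "cst A \<in> carrier_mat n n" and cB: "cst B \<in> carrier_mat n m" using carriers by auto
  have TB: "?T * cst B \<in> carrier_mat n m" using T(1) cB by (rule mult_carrier_mat)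
  have G: "G = ?T * cst B @\<^sub>r 1\<^sub>m m" by (simp add: popov_factor_def)
  have HG: "cst H * G = cst A * (?T * cst B) + cst B"
    unfolding G using append_cols_mult_append_rows[OF cA cB TB one_carrier_mat] cB
    by (simp add: map_mat_append_cols)
  have "cst J = 1\<^sub>m n @\<^sub>c 0\<^sub>m n m"
    by (intro eq_matI) (auto simp: state_proj_def)
  then have JG: "cst J * G = ?T * cst B"
    unfolding G using append_cols_mult_append_rows[OF one_carrier_mat zero_carrier_mat TB one_carrier_mat]
      left_mult_one_mat[OF TB] right_add_zero_mat[OF TB] by simp
  have "?M * (?T * cst B) = cst B"
  proof -
    have "?M * (?T * cst B) = ?M * ?T * cst B" using T(1) by (subst assoc_mult_mat_dim) auto
    then show ?thesis unfolding T(2) left_mult_one_mat[OF cB] .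
  qed
  moreover have "?M * (?T * cst B) = zvar \<cdot>\<^sub>m (?T * cst B) - cst A * (?T * cst B)"
  proof -
    have "(zvar \<cdot>\<^sub>m 1\<^sub>m n) * (?T * cst B) = zvar \<cdot>\<^sub>m (?T * cst B)"
      unfolding mult_smult_assoc_mat[OF one_carrier_mat TB] left_mult_one_mat[OF TB] ..
    then show ?thesis using T(1) by (subst minus_mult_dim) auto
  qed
  ultimately have e: "zvar \<cdot>\<^sub>m (?T * cst B) - cst A * (?T * cst B) = cst B" by simp
  show ?thesis
    unfolding HG JG
    by (rule add_eq_of_minus_eq_mat[OF e, of n m]) (use TB cA in auto)
qed

text \<open>Since \<open>H G = z J G\<close> and the para-conjugate of \<open>z\<close> is \<open>z\<^sup>-\<^sup>1\<close>, the terms \<open>G\<^sup>~ H\<^sup>* X H G\<close> and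
  \<open>G\<^sup>~ J\<^sup>* X J G\<close> coincide.\<close>

lemma popov_lure_mat:
  assumes X: "X \<in> carrier_mat n n"
  shows "\<Phi> = para_adjoint G * (cst (W X) * G)"
proof -
  note [simp] = carrier_matD[OF X]
  define Y where "Y = cst J * G"
  have Y: "dim_row Y = n" "dim_col Y = m" by (simp_all add: Y_def)
  have "cst (W X) * G = cst (mat_adjoint H) * (cst X * (cst H * G))
      - cst (mat_adjoint J) * (cst X * (cst J * G)) + cst Qh * G"
  proof -
    have "cst (W X) = cst (mat_adjoint H * (X * H)) - cst (mat_adjoint J * (X * J)) + cst Qh"
      by (intro eq_matI) (simp_all add: lure_mat_eq const_fract.hom_add const_fract.hom_minus
          del: index_mult_mat(1))
    then show ?thesis by (simp add: const_fract_mat_mult mat_dim_simps)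
  qed
  moreover have "para_adjoint G * (cst (mat_adjoint H) * (cst X * (cst H * G))) =
      para_adjoint (cst H * G) * (cst X * (cst H * G))"
    by (simp add: para_adjoint_mult para_adjoint_const assoc_mult_mat_dim)
  moreover have "para_adjoint G * (cst (mat_adjoint J) * (cst X * (cst J * G))) =
      para_adjoint Y * (cst X * Y)"
    by (simp add: para_adjoint_mult para_adjoint_const assoc_mult_mat_dim Y_def)
  moreover have "para_adjoint (cst H * G) * (cst X * (cst H * G)) = para_adjoint Y * (cst X * Y)"
  proof -
    have z: "inverse zvar * zvar = (1 :: 'a poly fract)"
      by (simp add: zvar_def)
    have "cst X * (zvar \<cdot>\<^sub>m Y) = zvar \<cdot>\<^sub>m (cst X * Y)"
      by (rule mult_smult_distrib[of _ n n _ m]) (use Y in \<open>auto intro: carrier_matI\<close>)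
    moreover have "para_adjoint Y * (zvar \<cdot>\<^sub>m (cst X * Y)) = zvar \<cdot>\<^sub>m (para_adjoint Y * (cst X * Y))"
      by (rule mult_smult_distrib[of _ m n _ m]) (use Y in \<open>auto intro: carrier_matI\<close>)
    moreover have "(inverse zvar \<cdot>\<^sub>m para_adjoint Y) * (zvar \<cdot>\<^sub>m (cst X * Y)) =
        inverse zvar \<cdot>\<^sub>m (para_adjoint Y * (zvar \<cdot>\<^sub>m (cst X * Y)))"
      by (rule mult_smult_assoc_mat[of _ m n _ m]) (use Y in \<open>auto intro: carrier_matI\<close>)
    ultimately show ?thesis
      unfolding popov_factor_shift Y_def[symmetric] para_adjoint_smult para_conj_zvar
      using z Y by (intro eq_matI) (simp_all flip: mult.assoc del: index_mult_mat(1))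
  qed
  ultimately have "para_adjoint G * (cst (W X) * G) =
      para_adjoint Y * (cst X * Y) - para_adjoint Y * (cst X * Y) + \<Phi>"
    using Y by (simp add: popov_eq mult_add_dim mult_minus_dim)
  also have "\<dots> = \<Phi>" using Y by (intro eq_matI) (simp_all del: index_mult_mat(1))
  finally show ?thesis ..
qed

lemma eval_char_poly:
  "eval_poly_at w (char_poly A) = det (w \<cdot>\<^sub>m 1\<^sub>m n - map_mat to_complex A)"
proof -
  interpret tc: field_hom "to_complex :: 'a \<Rightarrow> complex" by (rule field_hom_to_complex)
  have "map_mat (eval_poly_at w) (char_poly_matrix A) = w \<cdot>\<^sub>m 1\<^sub>m n - map_mat to_complex A"
    by (intro eq_matI) (auto simp: char_poly_matrix_def eval_poly_at_pCons to_complex_one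
        tc.hom_uminus)
  then show ?thesis unfolding char_poly_def by (simp flip: eval_poly_at.hom_det)
qed

text \<open>The resolvent is the adjugate of \<open>z I - A\<close> divided by the characteristic polynomial, so its poles are
  eigenvalues.\<close>

lemma regular_popov_factor:
  assumes det: "det (w \<cdot>\<^sub>m 1\<^sub>m n - map_mat to_complex A) \<noteq> 0"
  shows "regular_mat w G"
proof -
  let ?M = "zvar \<cdot>\<^sub>m 1\<^sub>m n - cst A"
  let ?T = "the (mat_inverse ?M)"
  let ?P = "char_poly_matrix A"
  note T = resolvent_inverse[OF carriers(1)]
  interpret tf: comm_ring_hom "to_fract :: 'a poly \<Rightarrow> 'a poly fract" by standard simp_all
  have P: "?P \<in> carrier_mat n n" using carriers by simp
  have M: "?M = map_mat to_fract ?P"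
    by (intro eq_matI)
      (auto simp: char_poly_matrix_def zvar_def const_fract_def simp flip: to_fract_uminus to_fract_diff)
  have d: "eval_poly_at w (det ?P) \<noteq> 0" using det by (simp add: char_poly_def flip: eval_char_poly)
  define D where "D = map_mat to_fract (adj_mat ?P)"
  have D: "D \<in> carrier_mat n n" using adj_mat(1)[OF P] by (simp add: D_def)
  have Mc: "?M \<in> carrier_mat n n" by (rule carrier_matI) simp_all
  have "D * ?M = map_mat to_fract (det ?P \<cdot>\<^sub>m 1\<^sub>m n)"
    unfolding D_def M using tf.mat_hom_mult[OF adj_mat(1)[OF P] P] adj_mat(3)[OF P] by simp
  also have "\<dots> = to_fract (det ?P) \<cdot>\<^sub>m 1\<^sub>m n" by (intro eq_matI) auto
  finally have DM: "D * ?M = \<dots>" .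
  have "D = D * ?M * ?T" using assoc_mult_mat[OF D Mc T(1)] T(2) D by simp
  also have "\<dots> = to_fract (det ?P) \<cdot>\<^sub>m ?T"
    unfolding DM using T(1) by (simp add: mult_smult_assoc_mat[of "1\<^sub>m n" n n _ n])
  finally have DT: "D = to_fract (det ?P) \<cdot>\<^sub>m ?T" .
  have "regular_at w (?T $$ (i, j))" if ij: "i < n" "j < n" for i j
  proof -
    have "to_fract (adj_mat ?P $$ (i, j)) = to_fract (det ?P) * ?T $$ (i, j)"
      using arg_cong[OF DT, of "\<lambda>M. M $$ (i, j)"] ij adj_mat(1)[OF P] T(1) by (simp add: D_def)
    moreover have "to_fract (det ?P) \<noteq> 0" using d by auto
    ultimately have "?T $$ (i, j) = to_fract (adj_mat ?P $$ (i, j)) * inverse (to_fract (det ?P))"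
      by (simp add: field_simps)
    then show ?thesis
      using d by (simp add: regular_at_mult regular_at_inverse regular_at_to_fract rat_eval_to_fract)
  qed
  then have "regular_mat w ?T" using T(1) by (auto simp: regular_mat_def)
  then have "regular_mat w (?T * cst B)" using T(1) by (intro regular_mat_mult) auto
  moreover have "regular_at w (1\<^sub>m m $$ (i, j) :: 'a poly fract)" if "i < m" "j < m" for i j
    using that regular_at_to_fract[of w "1 :: 'a poly"] regular_at_to_fract[of w "0 :: 'a poly"] by simp
  ultimately show ?thesis
    using T(1) by (auto simp: regular_mat_def popov_factor_def)
qed

end

section \<open>Pencils and neutral subspaces\<close>
lemma index_pencil:
  "i < dim_row A \<Longrightarrow> j < dim_col A \<Longrightarrow> dim_row E = dim_row A \<Longrightarrow> dim_col E = dim_col A \<Longrightarrow>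
    pencil E A $$ (i, j) = [:- A $$ (i, j), E $$ (i, j):]"
  by (simp add: pencil_def)

lemma dim_pencil [simp]: "dim_row (pencil E A) = dim_row A" "dim_col (pencil E A) = dim_col A"
  by (simp_all add: pencil_def)

lemma pencil_inject:
  assumes "E \<in> carrier_mat r c" "A \<in> carrier_mat r c" "E' \<in> carrier_mat r c" "A' \<in> carrier_mat r c"
  shows "pencil E A = pencil E' A' \<longleftrightarrow> E = E' \<and> A = A'"
proof
  assume e: "pencil E A = pencil E' A'"
  have "E $$ (i, j) = E' $$ (i, j) \<and> A $$ (i, j) = A' $$ (i, j)" if "i < r" "j < c" for i j
    using arg_cong[OF e, of "\<lambda>M. M $$ (i, j)"] that assms by (simp add: index_pencil)
  then show "E = E' \<and> A = A'" using assms by (intro conjI eq_matI) auto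
qed simp

lemma sum_linear_poly: "(\<Sum>i\<in>I. [:f i, g i:]) = [:sum f I, sum g I:]"
  by (induction I rule: infinite_finite_induct) auto

lemma pencil_mult_const:
  assumes "E \<in> carrier_mat r k" "A \<in> carrier_mat r k" "Y \<in> carrier_mat k c"
  shows "pencil E A * map_mat (\<lambda>c. [:c:]) Y = pencil (E * Y) (A * Y)"
  using assms
  by (intro eq_matI)
    (simp_all add: scalar_prod_def index_pencil sum_linear_poly mult.commute flip: sum_negf)

lemma const_mult_pencil:
  assumes "E \<in> carrier_mat k c" "A \<in> carrier_mat k c" "Z \<in> carrier_mat r k"
  shows "map_mat (\<lambda>c. [:c:]) Z * pencil E A = pencil (Z * E) (Z * A)"
  using assms
  by (intro eq_matI)
    (simp_all add: scalar_prod_def index_pencil sum_linear_poly mult.commute flip: sum_negf)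

lemma subspace_module_vec_iff:
  "VectorSpace.subspace class_ring W (module_vec TYPE('a :: field) N) \<longleftrightarrow>
    W \<subseteq> carrier_vec N \<and> 0\<^sub>v N \<in> W \<and> (\<forall>v\<in>W. \<forall>w\<in>W. v + w \<in> W) \<and> (\<forall>c. \<forall>v\<in>W. c \<cdot>\<^sub>v v \<in> W)"
  unfolding VectorSpace.subspace_def submodule_def
  using vec_vs[of N, where 'a = 'a] vec_module[of N, where 'a = 'a]
  by (auto simp: module_vec_simps class_ring_simps)

lemma mat_imageI: "Y \<in> carrier_mat N k \<Longrightarrow> v \<in> carrier_vec k \<Longrightarrow> Y *\<^sub>v v \<in> mat_image Y"
  by (simp add: mat_image_def)

lemma subspace_mat_image:
  assumes Y: "Y \<in> carrier_mat N k"
  shows "VectorSpace.subspace class_ring (mat_image Y) (module_vec TYPE('a :: field) N)"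
  unfolding subspace_module_vec_iff
proof (intro conjI ballI allI)
  show "mat_image Y \<subseteq> carrier_vec N" using Y by (auto simp: mat_image_def)
  have "0\<^sub>v N = Y *\<^sub>v 0\<^sub>v k" using Y by (intro eq_vecI) auto
  then show "0\<^sub>v N \<in> mat_image Y" using mat_imageI[OF Y zero_carrier_vec] by simp
next
  fix v w assume "v \<in> mat_image Y" "w \<in> mat_image Y"
  then obtain a b where "a \<in> carrier_vec k" "b \<in> carrier_vec k" "v = Y *\<^sub>v a" "w = Y *\<^sub>v b"
    using Y by (auto simp: mat_image_def)
  then have "v + w = Y *\<^sub>v (a + b)" "a + b \<in> carrier_vec k"
    using Y by (simp_all add: mult_add_distrib_mat_vec)
  then show "v + w \<in> mat_image Y" using mat_imageI[OF Y] by metis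
next
  fix c v assume "v \<in> mat_image Y"
  then obtain a where "a \<in> carrier_vec k" "v = Y *\<^sub>v a"
    using Y by (auto simp: mat_image_def)
  then have "c \<cdot>\<^sub>v v = Y *\<^sub>v (c \<cdot>\<^sub>v a)" "c \<cdot>\<^sub>v a \<in> carrier_vec k"
    using Y by (simp_all add: mult_mat_vec)
  then show "c \<cdot>\<^sub>v v \<in> mat_image Y" using mat_imageI[OF Y] by metis
qed

lemma mat_image_mult_subset:
  assumes "Y \<in> carrier_mat N k" "V \<in> carrier_mat k l"
  shows "mat_image (Y * V) \<subseteq> mat_image Y"
proof
  fix x assume "x \<in> mat_image (Y * V)"
  then obtain v where v: "v \<in> carrier_vec l" "x = Y * V *\<^sub>v v"
    using assms by (auto simp: mat_image_def)
  then have "x = Y *\<^sub>v (V *\<^sub>v v)" "V *\<^sub>v v \<in> carrier_vec k"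
    using assms assoc_mult_mat_vec[OF assms v(1)] by simp_all
  then show "x \<in> mat_image Y" using mat_imageI[OF assms(1)] by metis
qed

lemma mat_image_subset_factor:
  fixes Y :: "'a :: comm_ring_1 mat"
  assumes Y: "Y \<in> carrier_mat N k" and T: "T \<in> carrier_mat N l" and sub: "mat_image T \<subseteq> mat_image Y"
  shows "\<exists>C \<in> carrier_mat k l. T = Y * C"
proof (rule factor_through_cols[OF T Y])
  fix j assume j: "j < l"
  have "col T j = T *\<^sub>v unit_vec l j" using mult_unit_vec[OF T j] ..
  then have "col T j \<in> mat_image T" using mat_imageI[OF T unit_vec_carrier] by metis
  then show "\<exists>x\<in>carrier_vec k. col T j = Y *\<^sub>v x" using sub Y by (auto simp: mat_image_def)
qed

text \<open>Evaluating the form on columns of \<open>Y\<close>, that is, on images of unit vectors, recovers the entries of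
  \<open>Y\<^sup>* K Y\<close>.\<close>

lemma neutral_mat_image_iff:
  fixes K :: "'a :: conjugatable_field mat"
  assumes K: "K \<in> carrier_mat N N" and Y: "Y \<in> carrier_mat N k"
  shows "neutral K (mat_image Y) \<longleftrightarrow> mat_adjoint Y * (K * Y) = 0\<^sub>m k k"
proof -
  let ?P = "mat_adjoint Y * (K * Y)"
  have P: "?P \<in> carrier_mat k k" using K Y by (intro carrier_matI) auto
  have form: "(K *\<^sub>v (Y *\<^sub>v b)) \<bullet>c (Y *\<^sub>v a) = (?P *\<^sub>v b) \<bullet>c a"
    if "a \<in> carrier_vec k" "b \<in> carrier_vec k" for a b
  proof -
    have "?P *\<^sub>v b = mat_adjoint Y *\<^sub>v (K *\<^sub>v (Y *\<^sub>v b))"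
      using that K Y assoc_mult_mat_vec[of "mat_adjoint Y" k N "K * Y" k b] assoc_mult_mat_vec[OF K Y]
      by auto
    then show ?thesis
      using cscalar_prod_adjoint[of "mat_adjoint Y" k N "K *\<^sub>v (Y *\<^sub>v b)" a] that K Y by simp
  qed
  have "neutral K (mat_image Y) \<longleftrightarrow>
      (\<forall>a\<in>carrier_vec k. \<forall>b\<in>carrier_vec k. (?P *\<^sub>v b) \<bullet>c a = 0)"
    using K Y subspace_mat_image[OF Y] form by (auto simp: neutral_def mat_image_def)
  also have "\<dots> \<longleftrightarrow> ?P = 0\<^sub>m k k"
  proof
    assume z: "\<forall>a\<in>carrier_vec k. \<forall>b\<in>carrier_vec k. (?P *\<^sub>v b) \<bullet>c a = 0"
    show "?P = 0\<^sub>m k k"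
    proof (rule eq_matI)
      fix i j assume "i < dim_row (0\<^sub>m k k :: 'a mat)" "j < dim_col (0\<^sub>m k k :: 'a mat)"
      then have ij: "i < k" "j < k" by auto
      have "conjugate (unit_vec k i) = (unit_vec k i :: 'a vec)"
        by (intro eq_vecI) (auto simp: unit_vec_def)
      then have "(?P *\<^sub>v unit_vec k j) \<bullet>c unit_vec k i = ?P $$ (i, j)"
        using ij P K Y scalar_prod_right_unit[of i k "col ?P j"] by (simp add: mult_unit_vec[OF P] del: index_mult_mat(1))
      then show "?P $$ (i, j) = 0\<^sub>m k k $$ (i, j)" using z ij by simp
    qed (use P in auto)
  next
    assume z: "?P = 0\<^sub>m k k"
    have "0\<^sub>m k k *\<^sub>v b = 0\<^sub>v k" if "b \<in> carrier_vec k" for b :: "'a vec"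
      using that by (intro eq_vecI) auto
    then show "\<forall>a\<in>carrier_vec k. \<forall>b\<in>carrier_vec k. (?P *\<^sub>v b) \<bullet>c a = 0"
      unfolding z by auto
  qed
  finally show ?thesis .
qed

context lure_data begin

abbreviation "\<A> \<equiv> palindromic_mat A B Q S R"
abbreviation "F \<equiv> (1\<^sub>m n - A) @\<^sub>c (- B)"

lemma F_eq: "F = J - H"
  by (intro eq_matI) (auto simp: state_proj_def)

lemma palindromic_mat_blocks: "\<A> = four_block_mat (0\<^sub>m n n) H (mat_adjoint J) Qh"
  by (intro eq_matI)
    (auto simp: palindromic_mat_def Let_def weight_mat_def state_proj_def)

lemma palindromic_mat_adjoint_blocks:
  "mat_adjoint \<A> = four_block_mat (0\<^sub>m n n) J (mat_adjoint H) Qh"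
proof (rule eq_matI)
  have Qh: "conjugate (Qh $$ (j, i)) = Qh $$ (i, j)" if "i < n + m" "j < n + m" for i j
    using index_mat_adjoint[of i Qh j] that by simp
  fix i j assume "i < dim_row (four_block_mat (0\<^sub>m n n) J (mat_adjoint H) Qh)"
    "j < dim_col (four_block_mat (0\<^sub>m n n) J (mat_adjoint H) Qh)"
  then show "mat_adjoint \<A> $$ (i, j) = four_block_mat (0\<^sub>m n n) J (mat_adjoint H) Qh $$ (i, j)"
    by (simp add: palindromic_mat_blocks Qh)
qed (simp_all add: palindromic_mat_blocks)

lemma
  assumes P: "P \<in> carrier_mat n k" and V: "V \<in> carrier_mat (n + m) k"
  shows palindromic_mat_mult: "\<A> * (P @\<^sub>r V) = H * V @\<^sub>r (mat_adjoint J * P + Qh * V)"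
    and palindromic_mat_adjoint_mult: "mat_adjoint \<A> * (P @\<^sub>r V) = J * V @\<^sub>r (mat_adjoint H * P + Qh * V)"
    and palindromic_mat_diff_mult:
      "(mat_adjoint \<A> - \<A>) * (P @\<^sub>r V) = F * V @\<^sub>r (- (mat_adjoint F * P))"
proof -
  note [simp] = carrier_matD[OF P] carrier_matD[OF V]
  show A: "\<A> * (P @\<^sub>r V) = H * V @\<^sub>r (mat_adjoint J * P + Qh * V)"
    unfolding palindromic_mat_blocks
    by (subst four_block_mult_append_rows[of _ n n _ "n + m" _ "n + m" _ _ k])
      (auto intro!: carrier_matI)
  show A': "mat_adjoint \<A> * (P @\<^sub>r V) = J * V @\<^sub>r (mat_adjoint H * P + Qh * V)"
    unfolding palindromic_mat_adjoint_blocks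
    by (subst four_block_mult_append_rows[of _ n n _ "n + m" _ "n + m" _ _ k])
      (auto intro!: carrier_matI)
  have "(mat_adjoint \<A> - \<A>) * (P @\<^sub>r V) = mat_adjoint \<A> * (P @\<^sub>r V) - \<A> * (P @\<^sub>r V)"
    by (rule minus_mult_dim) (simp_all add: palindromic_mat_blocks)
  also have "\<dots> = F * V @\<^sub>r (- (mat_adjoint F * P))"
    unfolding A A' F_eq mat_adjoint_minus[of J H, simplified]
    by (simp add: minus_mult_dim, intro eq_matI) (auto simp del: index_mult_mat(1))
  finally show "(mat_adjoint \<A> - \<A>) * (P @\<^sub>r V) = F * V @\<^sub>r (- (mat_adjoint F * P))" .
qed

text \<open>Neutrality is the symmetry of \<open>P\<^sup>* (F V)\<close>; this is where the Hermitian matrix \<open>X\<close> comes from.\<close>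

lemma neutral_append_rows_iff:
  assumes P: "P \<in> carrier_mat n k" and V: "V \<in> carrier_mat (n + m) k"
  shows "neutral (mat_adjoint \<A> - \<A>) (mat_image (P @\<^sub>r V)) \<longleftrightarrow>
    mat_adjoint P * (F * V) = mat_adjoint (F * V) * P"
proof -
  note [simp] = carrier_matD[OF P] carrier_matD[OF V]
  let ?U = "F * V"
  have "mat_adjoint (P @\<^sub>r V) * ((mat_adjoint \<A> - \<A>) * (P @\<^sub>r V)) =
      (mat_adjoint P @\<^sub>c mat_adjoint V) * (?U @\<^sub>r (- (mat_adjoint F * P)))"
    by (simp add: palindromic_mat_diff_mult[OF P V] mat_adjoint_append_rows)
  also have "\<dots> = mat_adjoint P * ?U - mat_adjoint ?U * P"
    by (subst append_cols_mult_append_rows[of _ k n _ "n + m" _ k])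
      (auto intro!: carrier_matI simp: mat_dim_simps mat_adjoint_mult minus_add_uminus_mat[of _ k k])
  finally have "neutral (mat_adjoint \<A> - \<A>) (mat_image (P @\<^sub>r V)) \<longleftrightarrow>
      mat_adjoint P * ?U - mat_adjoint ?U * P = 0\<^sub>m k k"
    by (subst neutral_mat_image_iff[of _ "n + (n + m)" _ k])
      (auto intro!: carrier_matI simp: palindromic_mat_blocks)
  also have "\<dots> \<longleftrightarrow> mat_adjoint P * ?U = mat_adjoint ?U * P"
  proof
    assume z: "mat_adjoint P * ?U - mat_adjoint ?U * P = 0\<^sub>m k k"
    have "mat_adjoint ?U * P + 0\<^sub>m k k = mat_adjoint P * ?U"
      by (rule add_eq_of_minus_eq_mat[OF z, of k k]) (auto intro!: carrier_matI)
    moreover have "mat_adjoint ?U * P \<in> carrier_mat k k" by (rule carrier_matI) simp_all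
    ultimately show "mat_adjoint P * ?U = mat_adjoint ?U * P" by simp
  next
    assume "mat_adjoint P * ?U = mat_adjoint ?U * P"
    then show "mat_adjoint P * ?U - mat_adjoint ?U * P = 0\<^sub>m k k"
      by (simp add: minus_r_inv_mat[of _ k k] carrier_matI)
  qed
  finally show ?thesis .
qed

end

section \<open>From the pencil and the Popov function to the Lur'e matrix and back\<close>
lemma split_rows:
  assumes "M \<in> carrier_mat (a + b) c"
  obtains P Q where "P \<in> carrier_mat a c" "Q \<in> carrier_mat b c" "M = P @\<^sub>r Q"
proof
  let ?P = "mat a c (\<lambda>(i, j). M $$ (i, j))" and ?Q = "mat b c (\<lambda>(i, j). M $$ (i + a, j))"
  show "?P \<in> carrier_mat a c" "?Q \<in> carrier_mat b c" by simp_all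
  show "M = ?P @\<^sub>r ?Q" using assms by (intro eq_matI) auto
qed

lemma split_cols:
  assumes "M \<in> carrier_mat c (a + b)"
  obtains P Q where "P \<in> carrier_mat c a" "Q \<in> carrier_mat c b" "M = P @\<^sub>c Q"
proof
  let ?P = "mat c a (\<lambda>(i, j). M $$ (i, j))" and ?Q = "mat c b (\<lambda>(i, j). M $$ (i, j + a))"
  show "?P \<in> carrier_mat c a" "?Q \<in> carrier_mat c b" by simp_all
  show "M = ?P @\<^sub>c ?Q" using assms by (intro eq_matI) auto
qed

lemma append_rows_inject:
  assumes "P \<in> carrier_mat a c" "P' \<in> carrier_mat a c" "Q \<in> carrier_mat b c" "Q' \<in> carrier_mat b c"
  shows "P @\<^sub>r Q = P' @\<^sub>r Q' \<longleftrightarrow> P = P' \<and> Q = Q'"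
proof
  assume e: "P @\<^sub>r Q = P' @\<^sub>r Q'"
  have "P $$ (i, j) = P' $$ (i, j)" if "i < a" "j < c" for i j
    using arg_cong[OF e, of "\<lambda>M. M $$ (i, j)"] that assms by simp
  moreover have "Q $$ (i, j) = Q' $$ (i, j)" if "i < b" "j < c" for i j
    using arg_cong[OF e, of "\<lambda>M. M $$ (i + a, j)"] that assms by simp
  ultimately show "P = P' \<and> Q = Q'" using assms by (intro conjI eq_matI) auto
qed simp

lemma mult_mat_zero_vec:
  fixes M :: "'a :: comm_ring_1 mat"
  shows "M \<in> carrier_mat r c \<Longrightarrow> M *\<^sub>v 0\<^sub>v c = 0\<^sub>v r"
  by (intro eq_vecI) auto

lemma psd_gram: "psd (mat_adjoint M * M)"
  unfolding psd_def
proof (intro conjI ballI)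
  show "mat_adjoint (mat_adjoint M * M) = mat_adjoint M * M" by (simp add: mat_adjoint_mult)
  fix x :: "complex vec" assume "x \<in> carrier_vec (dim_row (mat_adjoint M * M))"
  then have x: "x \<in> carrier_vec (dim_col M)" by simp
  have M: "M \<in> carrier_mat (dim_row M) (dim_col M)" by simp
  have Mx: "M *\<^sub>v x \<in> carrier_vec (dim_row M)" using mult_mat_vec_carrier[OF M x] .
  have "((mat_adjoint M * M) *\<^sub>v x) \<bullet>c x = (mat_adjoint M *\<^sub>v (M *\<^sub>v x)) \<bullet>c x"
    unfolding assoc_mult_mat_vec[OF mat_adjoint_carrier[OF M] M x] ..
  also have "\<dots> = (M *\<^sub>v x) \<bullet>c (M *\<^sub>v x)"
    unfolding cscalar_prod_adjoint[OF mat_adjoint_carrier[OF M] Mx x] mat_adjoint_adjoint ..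
  finally show "0 \<le> ((mat_adjoint M * M) *\<^sub>v x) \<bullet>c x"
    using conjugate_square_ge_0_vec[of "M *\<^sub>v x"] by simp
qed

text \<open>The generic point at which rational functions are evaluated is complex also for the real field, so
  semidefiniteness has to be transferred back.\<close>

lemma nonneg_form_of_complex:
  fixes W :: "'a :: real_or_complex mat"
  assumes W: "W \<in> carrier_mat N N" and nn: "nonneg_form (map_mat to_complex W)"
  shows "nonneg_form W"
  unfolding nonneg_form_def
proof
  interpret tc: field_hom "to_complex :: 'a \<Rightarrow> complex" by (rule field_hom_to_complex)
  fix x :: "'a vec" assume "x \<in> carrier_vec (dim_row W)"
  then have x: "x \<in> carrier_vec N" using W by simp
  have "to_complex ((W *\<^sub>v x) \<bullet>c x) = (map_vec to_complex (W *\<^sub>v x)) \<bullet>c (map_vec to_complex x)"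
    using W x by (simp add: scalar_prod_def to_complex_sum to_complex_mult to_complex_conjugate)
  also have "map_vec to_complex (W *\<^sub>v x) = map_mat to_complex W *\<^sub>v map_vec to_complex x"
    by (rule tc.mult_mat_vec_hom[OF W x])
  finally show "0 \<le> to_complex ((W *\<^sub>v x) \<bullet>c x)"
    using nn W x by (simp add: nonneg_form_def)
qed

lemma append_cols_mult_append_vec:
  fixes P :: "'a :: comm_ring_1 mat"
  assumes "P \<in> carrier_mat r a" "Q \<in> carrier_mat r b" "u \<in> carrier_vec a" "v \<in> carrier_vec b"
  shows "(P @\<^sub>c Q) *\<^sub>v (u @\<^sub>v v) = P *\<^sub>v u + Q *\<^sub>v v"
proof (rule eq_vecI)
  fix i assume "i < dim_vec (P *\<^sub>v u + Q *\<^sub>v v)"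
  then have i: "i < r" using assms by simp
  have "row (P @\<^sub>c Q) i = row P i @\<^sub>v row Q i"
    using assms i by (intro eq_vecI) auto
  then show "((P @\<^sub>c Q) *\<^sub>v (u @\<^sub>v v)) $ i = (P *\<^sub>v u + Q *\<^sub>v v) $ i"
    using assms i scalar_prod_append[of "row P i" a "row Q i" b u v] by simp
qed (use assms in auto)

text \<open>\<open>I - P Z\<close> is the projection to the kernel of \<open>Z\<close>, which has dimension \<open>q\<close>.  More than \<open>q\<close> independent
  columns of it, together with the \<open>n\<close> columns of \<open>P\<close>, would satisfy a linear relation in dimension
  \<open>n + q\<close>; applying \<open>Z\<close> to the relation removes the part from the kernel of \<open>Z\<close>, so first the
  coefficients of \<open>P\<close> and then the others vanish.\<close>

lemma complementary_factorization:
  fixes Z :: "'a :: field mat"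
  assumes Z: "Z \<in> carrier_mat n (n + q)" and P: "P \<in> carrier_mat (n + q) n" and ZP: "Z * P = 1\<^sub>m n"
  shows "\<exists>r\<le>q. \<exists>P' \<in> carrier_mat (n + q) r. \<exists>C' \<in> carrier_mat r (n + q). 1\<^sub>m (n + q) - P * Z = P' * C'"
proof -
  define I where "I = 1\<^sub>m (n + q) - P * Z"
  note [simp] = carrier_matD[OF Z] carrier_matD[OF P]
  have I: "I \<in> carrier_mat (n + q) (n + q)" unfolding I_def by (rule carrier_matI) simp_all
  let ?r = "vec_space.rank (n + q) I"
  obtain P' C' S where P': "P' \<in> carrier_mat (n + q) ?r" and C': "C' \<in> carrier_mat ?r (n + q)"
    and S: "S \<in> carrier_mat (n + q) ?r" and fac: "I = P' * C'" "P' = I * S"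
    and li: "module.lin_indpt class_ring (module_vec TYPE('a) (n + q)) (set (cols P'))" "distinct (cols P')"
    using vec_space.rank_factorization[OF I] by blast
  have "Z * I = Z - (Z * P) * Z" using Z by (simp add: I_def mat_dim_simps)
  then have "Z * I = 0\<^sub>m n (n + q)" unfolding ZP using Z by simp
  then have ZP': "Z * P' = 0\<^sub>m n ?r"
    using S assoc_mult_mat[OF Z I S] by (simp flip: fac(2))
  have "?r \<le> q"
  proof (rule ccontr)
    assume "\<not> ?r \<le> q"
    then have "n + q < n + ?r" by simp
    then obtain v where v: "v \<in> carrier_vec (n + ?r)" "v \<noteq> 0\<^sub>v (n + ?r)"
      "(P @\<^sub>c P') *\<^sub>v v = 0\<^sub>v (n + q)"
      using wide_mat_kernel[OF append_cols_carrier[OF P P']] by blast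
    define a b where "a = vec_first v n" and "b = vec_last v ?r"
    have ab: "a \<in> carrier_vec n" "b \<in> carrier_vec ?r" "v = a @\<^sub>v b"
      using v(1) by (simp_all add: a_def b_def)
    have sum0: "P *\<^sub>v a + P' *\<^sub>v b = 0\<^sub>v (n + q)"
      using v(3) append_cols_mult_append_vec[OF P P' ab(1,2)] ab(3) by simp
    have "Z *\<^sub>v (P *\<^sub>v a + P' *\<^sub>v b) = 1\<^sub>m n *\<^sub>v a + 0\<^sub>m n ?r *\<^sub>v b"
      using mult_add_distrib_mat_vec[OF Z, of "P *\<^sub>v a" "P' *\<^sub>v b"] ab P P'
        assoc_mult_mat_vec[OF Z P ab(1)] assoc_mult_mat_vec[OF Z P' ab(2)] ZP ZP' by simp
    also have "0\<^sub>m n ?r *\<^sub>v b = 0\<^sub>v n" using ab(2) by (intro eq_vecI) auto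
    also have "1\<^sub>m n *\<^sub>v a + 0\<^sub>v n = a" using ab by simp
    finally have a: "a = 0\<^sub>v n" using sum0 mult_mat_zero_vec[OF Z] by simp
    then have "P *\<^sub>v a = 0\<^sub>v (n + q)" using mult_mat_zero_vec[OF P] by simp
    then have Pb: "P' *\<^sub>v b = 0\<^sub>v (n + q)" using sum0 P' ab by simp
    have "b \<noteq> 0\<^sub>v ?r" using v(2) a ab(3) by (auto simp: append_vec_def)
    then show False using vec_space.lin_depI[OF P' ab(2) _ Pb li(2)] li(1) by blast
  qed
  then show ?thesis using P' C' fac(1) unfolding I_def by blast
qed

context lure_data begin

text \<open>\<open>\<Phi> = (D G)\<^sup>~ (D G)\<close> is a Gram matrix wherever \<open>G\<close> can be evaluated.\<close>

lemma psd_popov_of_gram: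
  assumes X: "X \<in> carrier_mat n n" and D: "D \<in> carrier_mat q (n + m)" "W X = mat_adjoint D * D"
    and w: "w * cnj w = 1" and det: "det (w \<cdot>\<^sub>m 1\<^sub>m n - map_mat to_complex A) \<noteq> 0"
  shows "psd (map_mat (rat_eval w) \<Phi>)"
proof -
  note [simp] = carrier_matD[OF D(1)]
  define N where "N = cst D * G"
  have N: "regular_mat w N"
    unfolding N_def by (intro regular_mat_mult regular_popov_factor[OF det]) simp_all
  have "\<Phi> = para_adjoint N * N"
    unfolding popov_lure_mat[OF X] N_def D(2)
    by (simp add: para_adjoint_mult para_adjoint_const const_fract_mat_mult assoc_mult_mat_dim)
  then have "map_mat (rat_eval w) \<Phi> =
      mat_adjoint (map_mat (rat_eval w) N) * map_mat (rat_eval w) N"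
    using N regular_mat_para_adjoint[OF w N]
    by (simp add: rat_eval_mat_mult rat_eval_mat_para_adjoint[OF w])
  then show ?thesis by (simp add: psd_gram)
qed

text \<open>Modulo the graph every vector \<open>w\<close> of a larger neutral space has the form \<open>(d, 0)\<close>.  Pairing it with
  the graph vector over \<open>c\<close> gives \<open>d\<^sup>* F c\<close>, so \<open>d = 0\<close> because \<open>F\<close> is surjective.\<close>

lemma maximally_neutral_graph:
  assumes X: "X \<in> carrier_mat n n" "mat_adjoint X = X"
    and Fi: "Fi \<in> carrier_mat (n + m) n" "F * Fi = 1\<^sub>m n"
  shows "maximally_neutral (mat_adjoint \<A> - \<A>) (mat_image (X * F @\<^sub>r 1\<^sub>m (n + m)))"
proof -
  define Y where "Y = X * F @\<^sub>r 1\<^sub>m (n + m)"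
  define K where "K = mat_adjoint \<A> - \<A>"
  note [simp] = carrier_matD[OF X(1)] carrier_matD[OF Fi(1)]
  have F: "F \<in> carrier_mat n (n + m)" by (rule carrier_matI) simp_all
  have XF: "X * F \<in> carrier_mat n (n + m)" using X(1) F by (rule mult_carrier_mat)
  have Y: "Y \<in> carrier_mat (n + (n + m)) (n + m)"
    unfolding Y_def using XF one_carrier_mat by (rule carrier_append_rows)
  have K: "K \<in> carrier_mat (n + (n + m)) (n + (n + m))"
    by (rule carrier_matI) (simp_all add: K_def palindromic_mat_blocks)
  have F1: "F * 1\<^sub>m (n + m) = F" using F by simp
  have neutral: "neutral K (mat_image Y)"
    unfolding K_def Y_def neutral_append_rows_iff[OF XF one_carrier_mat] F1
    by (simp add: mat_adjoint_mult X(2) assoc_mult_mat_dim)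
  have "w \<in> mat_image Y" if W: "mat_image Y \<subseteq> W" "neutral K W" and w: "w \<in> W" for W w
  proof -
    have sub: "W \<subseteq> carrier_vec (n + (n + m))" "\<And>v w. v \<in> W \<Longrightarrow> w \<in> W \<Longrightarrow> v + w \<in> W"
      "\<And>c v. v \<in> W \<Longrightarrow> c \<cdot>\<^sub>v v \<in> W"
      and form: "\<And>x y. x \<in> W \<Longrightarrow> y \<in> W \<Longrightarrow> (K *\<^sub>v y) \<bullet>c x = 0"
      using W(2) K by (auto simp: neutral_def subspace_module_vec_iff)
    define u v where "u = vec_first w n" and "v = vec_last w (n + m)"
    have uv: "u \<in> carrier_vec n" "v \<in> carrier_vec (n + m)" "w = u @\<^sub>v v"
      using w sub(1) by (auto simp: u_def v_def)
    have Yv: "Y *\<^sub>v c = ((X * F) *\<^sub>v c) @\<^sub>v c" if "c \<in> carrier_vec (n + m)" for c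
      unfolding Y_def mat_mult_append[OF XF one_carrier_mat that] using that by simp
    define d where "d = u - (X * F) *\<^sub>v v"
    have d: "d \<in> carrier_vec n" using uv XF unfolding d_def by (intro minus_carrier_vec) auto
    have "d @\<^sub>v 0\<^sub>v (n + m) = w + (- 1) \<cdot>\<^sub>v (Y *\<^sub>v v)"
      unfolding Yv[OF uv(2)] uv(3) d_def using uv(1,2) XF
      by (intro eq_vecI) (auto simp del: index_mult_mat_vec)
    also have "\<dots> \<in> W" using sub w W(1) mat_imageI[OF Y uv(2)] by blast
    finally have dW: "d @\<^sub>v 0\<^sub>v (n + m) \<in> W" .
    define c where "c = Fi *\<^sub>v d"
    have c: "c \<in> carrier_vec (n + m)" using Fi d by (auto simp: c_def)
    have Fc: "F *\<^sub>v c = d"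
      unfolding c_def using assoc_mult_mat_vec[OF F Fi(1) d] Fi(2) d by simp
    have KY: "K * Y = F @\<^sub>r (- (mat_adjoint F * (X * F)))"
      unfolding K_def Y_def palindromic_mat_diff_mult[OF XF one_carrier_mat] F1 ..
    define t where "t = (- (mat_adjoint F * (X * F))) *\<^sub>v c"
    have t: "t \<in> carrier_vec (n + m)" unfolding t_def by (rule carrier_vecI) simp
    have G: "- (mat_adjoint F * (X * F)) \<in> carrier_mat (n + m) (n + m)" by (rule carrier_matI) simp_all
    have "K *\<^sub>v (Y *\<^sub>v c) = d @\<^sub>v t"
      using assoc_mult_mat_vec[OF K Y c] mat_mult_append[OF F G c]
      unfolding KY t_def Fc by simp
    then have "(d @\<^sub>v t) \<bullet>c (d @\<^sub>v 0\<^sub>v (n + m)) = 0"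
      using form[OF dW, of "Y *\<^sub>v c"] W(1) mat_imageI[OF Y c] by auto
    moreover have "conjugate (d @\<^sub>v 0\<^sub>v (n + m)) = conjugate d @\<^sub>v 0\<^sub>v (n + m)"
      using d by (intro eq_vecI) auto
    ultimately have "d \<bullet>c d = 0"
      using scalar_prod_append[OF d t, of "conjugate d" "0\<^sub>v (n + m)"] d t by simp
    then have "d = 0\<^sub>v n" using cscalar_prod_self_eq_0[of d] d by simp
    then have "u = (X * F) *\<^sub>v v"
      using uv XF by (auto simp: d_def vec_eq_iff)
    then have "w = Y *\<^sub>v v" using Yv[OF uv(2)] uv(3) by simp
    then show ?thesis using mat_imageI[OF Y uv(2)] by simp
  qed
  then show ?thesis
    using neutral unfolding maximally_neutral_def K_def Y_def by blast
qed

text \<open>With \<open>U = F V\<close>, a right inverse \<open>N\<close> of \<open>U\<close> and \<open>X = P N\<close>, symmetry of \<open>P\<^sup>* U\<close> gives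
  \<open>P = (U N)\<^sup>* P = N\<^sup>* P\<^sup>* U = X\<^sup>* U\<close>, and then \<open>X = P N = X\<^sup>*\<close>.  So \<open>im [P; V]\<close> lies in the graph of \<open>X F\<close>, which
  is neutral, and maximality makes the two equal.\<close>

lemma maximally_neutral_normal_form:
  assumes P: "P \<in> carrier_mat n (n + m)" and V: "V \<in> carrier_mat (n + m) (n + m)"
    and N: "N \<in> carrier_mat (n + m) n" "F * V * N = 1\<^sub>m n"
    and max: "maximally_neutral (mat_adjoint \<A> - \<A>) (mat_image (P @\<^sub>r V))"
  shows "\<exists>X \<in> carrier_mat n n. mat_adjoint X = X \<and>
    (\<exists>C \<in> carrier_mat (n + m) (n + m). X * F @\<^sub>r 1\<^sub>m (n + m) = (P @\<^sub>r V) * C)"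
proof -
  define U where "U = F * V"
  define X where "X = P * N"
  define K where "K = mat_adjoint \<A> - \<A>"
  note [simp] = carrier_matD[OF P] carrier_matD[OF V] carrier_matD[OF N(1)]
  have F: "F \<in> carrier_mat n (n + m)" by (rule carrier_matI) simp_all
  have U: "U \<in> carrier_mat n (n + m)" unfolding U_def by (rule carrier_matI) simp_all
  note [simp] = carrier_matD[OF U]
  have X: "X \<in> carrier_mat n n" unfolding X_def by (rule carrier_matI) simp_all
  have UN: "U * N = 1\<^sub>m n" using N(2) by (simp add: U_def)
  have sym: "mat_adjoint P * U = mat_adjoint U * P"
    using max neutral_append_rows_iff[OF P V] by (simp add: maximally_neutral_def U_def)
  have "P = mat_adjoint (U * N) * P" using P UN by simp
  also have "\<dots> = mat_adjoint N * (mat_adjoint U * P)"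
    by (simp add: mat_adjoint_mult assoc_mult_mat_dim)
  also have "\<dots> = mat_adjoint X * U"
    by (simp add: X_def mat_adjoint_mult assoc_mult_mat_dim flip: sym)
  finally have PX: "P = mat_adjoint X * U" .
  have "X = mat_adjoint X * (U * N)"
    unfolding X_def by (subst PX) (simp add: X_def assoc_mult_mat_dim)
  also have "\<dots> = mat_adjoint X" using X UN by simp
  finally have herm: "mat_adjoint X = X" ..
  let ?Y = "X * F @\<^sub>r 1\<^sub>m (n + m)"
  have XF: "X * F \<in> carrier_mat n (n + m)" using X F by (rule mult_carrier_mat)
  have Y: "?Y \<in> carrier_mat (n + (n + m)) (n + m)"
    using XF one_carrier_mat by (rule carrier_append_rows)
  have PV: "P @\<^sub>r V \<in> carrier_mat (n + (n + m)) (n + m)" using P V by (rule carrier_append_rows)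
  have "P @\<^sub>r V = ?Y * V"
    unfolding append_rows_mult[OF XF one_carrier_mat V]
    using V X PX by (simp add: herm U_def assoc_mult_mat_dim)
  then have "mat_image (P @\<^sub>r V) \<subseteq> mat_image ?Y" using mat_image_mult_subset[OF Y V] by simp
  moreover have "neutral K (mat_image ?Y)"
    unfolding K_def neutral_append_rows_iff[OF XF one_carrier_mat]
    using X F by (simp add: mat_adjoint_mult herm assoc_mult_mat_dim)
  ultimately have "mat_image ?Y = mat_image (P @\<^sub>r V)"
    using max unfolding maximally_neutral_def K_def by blast
  then show ?thesis using mat_image_subset_factor[OF PV Y] X herm by blast
qed

text \<open>The lower blocks of \<open>\<A>\<^sup>* Y\<close> and \<open>\<A> Y\<close> for \<open>Y = [-X F; I]\<close>: up to the multiple \<open>F\<^sup>* X\<close> of the upper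
  block, each of them is \<open>W(X)\<close>.\<close>

lemma lure_mat_shift:
  assumes X: "X \<in> carrier_mat n n"
  shows "mat_adjoint H * ((- X) * F) + Qh = mat_adjoint F * X * J + W X"
    and "mat_adjoint J * ((- X) * F) + Qh = mat_adjoint F * X * H + W X"
proof -
  note [simp] = carrier_matD[OF X]
  show "mat_adjoint H * ((- X) * F) + Qh = mat_adjoint F * X * J + W X"
    unfolding F_eq lure_mat_eq
    by (simp add: mat_dim_simps mat_adjoint_simps, intro eq_matI) (simp_all del: index_mult_mat(1))
  show "mat_adjoint J * ((- X) * F) + Qh = mat_adjoint F * X * H + W X"
    unfolding F_eq lure_mat_eq
    by (simp add: mat_dim_simps mat_adjoint_simps, intro eq_matI) (simp_all del: index_mult_mat(1))
qed

text \<open>By the previous lemma, undoing the row operation multiplies \<open>[J; W(X)]\<close> and \<open>[H; W(X)]\<close> by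
  \<open>[I 0; F\<^sup>* X I]\<close> from the left, and \<open>W(X) = D\<^sup>* D\<close> lets \<open>D\<^sup>*\<close> be absorbed into that factor.\<close>

lemma deflating_of_gram:
  assumes X: "X \<in> carrier_mat n n" "mat_adjoint X = X"
    and D: "D \<in> carrier_mat q (n + m)" "W X = mat_adjoint D * D"
  defines "Y \<equiv> (- X) * F @\<^sub>r 1\<^sub>m (n + m)"
    and "Z \<equiv> (1\<^sub>m n @\<^sub>c 0\<^sub>m n q) @\<^sub>r (mat_adjoint F * X @\<^sub>c mat_adjoint D)"
  shows "mat_adjoint \<A> * Y = Z * (J @\<^sub>r D)" and "\<A> * Y = Z * (H @\<^sub>r D)"
proof -
  note [simp] = carrier_matD[OF X(1)] carrier_matD[OF D(1)]
  have J: "J \<in> carrier_mat n (n + m)" and H: "H \<in> carrier_mat n (n + m)"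
    by (rule carrier_matI; simp)+
  have Yc: "(- X) * F \<in> carrier_mat n (n + m)" by (rule carrier_matI) simp_all
  have FX: "mat_adjoint F * X \<in> carrier_mat (n + m) n" by (rule carrier_matI) simp_all
  have D': "mat_adjoint D \<in> carrier_mat (n + m) q" using D(1) by simp
  have Z: "Z * (M @\<^sub>r D) = M @\<^sub>r (mat_adjoint F * X * M + W X)" if M: "M \<in> carrier_mat n (n + m)" for M
  proof -
    have "Z * (M @\<^sub>r D) = (1\<^sub>m n @\<^sub>c 0\<^sub>m n q) * (M @\<^sub>r D)
        @\<^sub>r (mat_adjoint F * X @\<^sub>c mat_adjoint D) * (M @\<^sub>r D)"
      unfolding Z_def
      using append_cols_carrier[OF one_carrier_mat zero_carrier_mat] append_cols_carrier[OF FX D']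
        carrier_append_rows[OF M D(1)]
      by (rule append_rows_mult)
    moreover have "(1\<^sub>m n @\<^sub>c 0\<^sub>m n q) * (M @\<^sub>r D) = M"
      using append_cols_mult_append_rows[OF one_carrier_mat zero_carrier_mat M D(1)] M D(1) by simp
    moreover have "(mat_adjoint F * X @\<^sub>c mat_adjoint D) * (M @\<^sub>r D) = mat_adjoint F * X * M + W X"
      unfolding append_cols_mult_append_rows[OF FX D' M D(1)] D(2) ..
    ultimately show ?thesis by simp
  qed
  have Qh: "Qh \<in> carrier_mat (n + m) (n + m)" by (rule carrier_matI) simp_all
  show "mat_adjoint \<A> * Y = Z * (J @\<^sub>r D)"
    unfolding Y_def palindromic_mat_adjoint_mult[OF Yc one_carrier_mat] Z[OF J]
    using J Qh lure_mat_shift(1)[OF X(1)] by simp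
  show "\<A> * Y = Z * (H @\<^sub>r D)"
    unfolding Y_def palindromic_mat_mult[OF Yc one_carrier_mat] Z[OF H]
    using H Qh lure_mat_shift(2)[OF X(1)] by simp
qed

text \<open>With \<open>Z\<^sub>1\<close>, \<open>Z\<^sub>2\<close> the blocks of \<open>Z\<close> and \<open>T = Z\<^sub>2 - F\<^sup>* X Z\<^sub>1\<close>, the factorization says \<open>Z\<^sub>1 E = J\<close>,
  \<open>Z\<^sub>1 A\<^sub>1 = H\<close>, \<open>T E = T A\<^sub>1 = W(X)\<close>.  Hence \<open>Z\<^sub>1 (E - A\<^sub>1) = F\<close> and \<open>T (E - A\<^sub>1) = 0\<close>: the space of dimension
  \<open>n + q\<close> loses \<open>n\<close> dimensions to \<open>F\<close>, and \<open>W(X) = T E\<close> passes through the remaining \<open>q\<close>.\<close>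

lemma lure_mat_factorization_of_deflating:
  assumes X: "X \<in> carrier_mat n n" "mat_adjoint X = X"
    and Fi: "Fi \<in> carrier_mat (n + m) n" "F * Fi = 1\<^sub>m n"
    and Z: "Z \<in> carrier_mat (n + (n + m)) (n + q)"
    and E: "E \<in> carrier_mat (n + q) (n + m)" and A1: "A1 \<in> carrier_mat (n + q) (n + m)"
  defines "Y \<equiv> (- X) * F @\<^sub>r 1\<^sub>m (n + m)"
  assumes YE: "mat_adjoint \<A> * Y = Z * E" and YA: "\<A> * Y = Z * A1"
  shows "\<exists>r\<le>q. \<exists>P \<in> carrier_mat (n + m) r. \<exists>C \<in> carrier_mat r (n + m). W X = P * C"
proof -
  note [simp] = carrier_matD[OF X(1)] carrier_matD[OF Fi(1)] carrier_matD[OF E] carrier_matD[OF A1]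
  obtain Z1 Z2 where Z1: "Z1 \<in> carrier_mat n (n + q)" and Z2: "Z2 \<in> carrier_mat (n + m) (n + q)"
    and Zs: "Z = Z1 @\<^sub>r Z2" using split_rows[OF Z] by metis
  note [simp] = carrier_matD[OF Z1] carrier_matD[OF Z2]
  have J: "J \<in> carrier_mat n (n + m)" and H: "H \<in> carrier_mat n (n + m)"
    and Qh: "Qh \<in> carrier_mat (n + m) (n + m)" by (rule carrier_matI; simp)+
  have Yc: "(- X) * F \<in> carrier_mat n (n + m)" by (rule carrier_matI) simp_all
  have c: "mat_adjoint F * X * M + W X \<in> carrier_mat (n + m) (n + m)" if "M \<in> carrier_mat n (n + m)" for M
    using that by (intro carrier_matI) auto
  have "J @\<^sub>r (mat_adjoint F * X * J + W X) = Z1 * E @\<^sub>r Z2 * E"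
    using YE J Qh lure_mat_shift(1)[OF X(1)] unfolding Y_def palindromic_mat_adjoint_mult[OF Yc one_carrier_mat]
      Zs append_rows_mult[OF Z1 Z2 E] by simp
  then have ZE: "Z1 * E = J" "Z2 * E = mat_adjoint F * X * J + W X"
    using append_rows_inject[OF J _ c[OF J], of "Z1 * E" "Z2 * E"] Z1 Z2 E by auto
  have "H @\<^sub>r (mat_adjoint F * X * H + W X) = Z1 * A1 @\<^sub>r Z2 * A1"
    using YA H Qh lure_mat_shift(2)[OF X(1)] unfolding Y_def palindromic_mat_mult[OF Yc one_carrier_mat]
      Zs append_rows_mult[OF Z1 Z2 A1] by simp
  then have ZA: "Z1 * A1 = H" "Z2 * A1 = mat_adjoint F * X * H + W X"
    using append_rows_inject[OF H _ c[OF H], of "Z1 * A1" "Z2 * A1"] Z1 Z2 A1 by auto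
  define T where "T = Z2 - mat_adjoint F * X * Z1"
  have T: "T \<in> carrier_mat (n + m) (n + q)" unfolding T_def by (rule carrier_matI) simp_all
  note [simp] = carrier_matD[OF T]
  have TM: "T * M' = W X" if "Z1 * M' = M" "Z2 * M' = mat_adjoint F * X * M + W X"
    "M' \<in> carrier_mat (n + q) (n + m)" for M M'
  proof -
    have M: "dim_row M = n" "dim_col M = n + m" using that(1,3) by auto
    have "T * M' = Z2 * M' - mat_adjoint F * X * (Z1 * M')"
      using that(3) unfolding T_def by (simp add: minus_mult_dim assoc_mult_mat_dim)
    also have "\<dots> = W X"
      unfolding that(1,2) using M by (intro eq_matI) (simp_all del: index_mult_mat(1))
    finally show ?thesis .
  qed
  have TE: "T * E = W X" and TA: "T * A1 = W X" using TM ZE ZA E A1 by blast+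
  define P0 where "P0 = (E - A1) * Fi"
  have P0: "P0 \<in> carrier_mat (n + q) n" unfolding P0_def by (rule carrier_matI) simp_all
  note [simp] = carrier_matD[OF P0]
  have "Z1 * P0 = (Z1 * E - Z1 * A1) * Fi" unfolding P0_def by (simp add: mat_dim_simps)
  then have ZP: "Z1 * P0 = 1\<^sub>m n" unfolding ZE ZA using Fi(2) by (simp add: F_eq)
  have "T * P0 = (T * E - T * A1) * Fi" unfolding P0_def by (simp add: mat_dim_simps)
  then have TP: "T * P0 = 0\<^sub>m (n + m) n"
    unfolding TE TA using Fi(1) by (simp add: minus_r_inv_mat[of _ "n + m" "n + m"] carrier_matI)
  obtain r P' C' where r: "r \<le> q" and P': "P' \<in> carrier_mat (n + q) r"
    and C': "C' \<in> carrier_mat r (n + q)" and fac: "1\<^sub>m (n + q) - P0 * Z1 = P' * C'"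
    using complementary_factorization[OF Z1 P0 ZP] by blast
  note [simp] = carrier_matD[OF P'] carrier_matD[OF C']
  have "T = T - T * P0 * Z1" unfolding TP using T Z1 by (intro eq_matI) auto
  also have "\<dots> = T * (1\<^sub>m (n + q) - P0 * Z1)" using T by (simp add: mat_dim_simps)
  finally have "T * E = T * (P' * C') * E" unfolding fac by simp
  then have "W X = (T * P') * (C' * E)" unfolding TE by (simp add: assoc_mult_mat_dim)
  moreover have "T * P' \<in> carrier_mat (n + m) r" "C' * E \<in> carrier_mat r (n + m)"
    using T P' C' E by (auto intro!: carrier_matI)
  ultimately show ?thesis using r by blast
qed

text \<open>The rank condition makes \<open>C G\<close> right invertible over the rational functions, and this turns
  \<open>\<Phi> = G\<^sup>~ W G\<close> around into \<open>W = T\<^sup>~ \<Phi> T\<close>.  One generic point of the circle then suffices.\<close>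

lemma nonneg_lure_mat_of_popov:
  assumes X: "X \<in> carrier_mat n n" "mat_adjoint X = X"
    and P: "P \<in> carrier_mat (n + m) r" and C: "C \<in> carrier_mat r (n + m)" and PC: "W X = P * C"
    and r: "r \<le> vec_space.rank m \<Phi>"
    and psd: "\<And>\<omega>. \<omega> \<in> {0..<2 * pi} \<Longrightarrow> det (cis \<omega> \<cdot>\<^sub>m 1\<^sub>m n - map_mat to_complex A) \<noteq> 0 \<Longrightarrow>
      psd (map_mat (rat_eval (cis \<omega>)) \<Phi>)"
  shows "nonneg_form (W X)"
proof -
  note [simp] = carrier_matD[OF X(1)] carrier_matD[OF P] carrier_matD[OF C]
  let ?M = "cst C * G"
  have M: "?M \<in> carrier_mat r m" by (rule carrier_matI) simp_all
  have Phi: "\<Phi> = (para_adjoint G * cst P) * ?M"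
    unfolding popov_lure_mat[OF X(1)] PC by (simp add: const_fract_mat_mult assoc_mult_mat_dim)
  obtain P' C' where P': "P' \<in> carrier_mat r (vec_space.rank r ?M)"
    and C': "C' \<in> carrier_mat (vec_space.rank r ?M) m" and MPC: "?M = P' * C'"
    using vec_space.rank_factorization[OF M] by blast
  note [simp] = carrier_matD[OF P'] carrier_matD[OF C']
  have "\<Phi> = (para_adjoint G * cst P * P') * C'"
    unfolding Phi MPC by (simp add: assoc_mult_mat_dim)
  moreover have "para_adjoint G * cst P * P' \<in> carrier_mat m (vec_space.rank r ?M)"
    by (rule carrier_matI) simp_all
  ultimately have "vec_space.rank m \<Phi> \<le> vec_space.rank r ?M"
    using vec_space.rank_le_inner_dim[OF _ C'] by simp
  moreover have "vec_space.rank r ?M \<le> r"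
    using vec_space.rank_le_inner_dim[OF one_carrier_mat M] M by simp
  ultimately obtain N where N: "N \<in> carrier_mat m r" "?M * N = 1\<^sub>m r"
    using vec_space.full_row_rank_right_inverse[OF M] r by (metis le_antisym order_trans)
  note [simp] = carrier_matD[OF N(1)]
  define T where "T = N * cst C"
  have T: "T \<in> carrier_mat m (n + m)" unfolding T_def by (rule carrier_matI) simp_all
  note [simp] = carrier_matD[OF T]
  have "cst (W X) * (G * T) = cst P * ((?M * N) * cst C)"
    unfolding PC T_def by (simp add: const_fract_mat_mult assoc_mult_mat_dim)
  also have "\<dots> = cst (W X)"
    unfolding N(2) PC using C by (simp add: const_fract_mat_mult)
  finally have WGT: "cst (W X) * (G * T) = cst (W X)" .
  have "cst (W X) = para_adjoint (cst (W X))"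
    by (simp add: para_adjoint_const lure_mat_hermitian[OF X])
  also have "\<dots> = para_adjoint (G * T) * cst (W X)"
    by (subst WGT[symmetric]) (simp add: para_adjoint_mult para_adjoint_const lure_mat_hermitian[OF X]
        assoc_mult_mat_dim)
  also have "\<dots> = para_adjoint (G * T) * (cst (W X) * (G * T))" unfolding WGT ..
  also have "\<dots> = para_adjoint T * \<Phi> * T"
    unfolding popov_lure_mat[OF X(1)] by (simp add: para_adjoint_mult assoc_mult_mat_dim)
  finally have WT: "cst (W X) = para_adjoint T * \<Phi> * T" .
  define bad where "bad = {w. \<not> regular_mat w T} \<union> {w. eval_poly_at w (char_poly A) = 0}"
  have "char_poly A \<noteq> 0" using degree_monic_char_poly[OF carriers(1)] by auto
  then have "map_poly to_complex (char_poly A) \<noteq> 0"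
    by (simp add: poly_eq_iff coeff_map_poly)
  then have "finite bad"
    unfolding bad_def eval_poly_at_def by (simp add: finite_not_regular_mat poly_roots_finite)
  \<comment> \<open>Half of the circle is enough, and on it the cosine separates points.\<close>
  moreover have inj: "inj_on cis {0..<pi}"
  proof (rule inj_onI)
    fix x y assume "x \<in> {0..<pi}" "y \<in> {0..<pi}" "cis x = cis y"
    then show "x = y" using cos_inj_pi[of x y] by (auto dest: arg_cong[of _ _ Re])
  qed
  have "infinite (cis ` {0..<pi})"
    using finite_imageD[OF _ inj] infinite_Ico[OF pi_gt_zero] by blast
  ultimately have "\<not> cis ` {0..<pi} \<subseteq> bad" using finite_subset by blast
  then obtain \<omega> where \<omega>: "\<omega> \<in> {0..<2 * pi}" "cis \<omega> \<notin> bad" by fastforce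
  let ?w = "cis \<omega>"
  have circle: "?w * cnj ?w = 1" by (simp add: cis_cnj cis_mult)
  have det: "det (?w \<cdot>\<^sub>m 1\<^sub>m n - map_mat to_complex A) \<noteq> 0"
    using \<omega>(2) by (simp add: bad_def flip: eval_char_poly)
  have regT: "regular_mat ?w T" using \<omega>(2) by (simp add: bad_def)
  have regG: "regular_mat ?w G" by (rule regular_popov_factor[OF det])
  have reg: "regular_mat ?w \<Phi>"
    unfolding popov_eq by (intro regular_mat_mult regular_mat_para_adjoint circle regG) simp_all
  let ?T = "map_mat (rat_eval ?w) T" and ?\<Phi> = "map_mat (rat_eval ?w) \<Phi>"
  have "map_mat to_complex (W X) = map_mat (rat_eval ?w) (para_adjoint T * \<Phi> * T)"
    by (simp add: rat_eval_mat_const flip: WT)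
  also have "\<dots> = mat_adjoint ?T * ?\<Phi> * ?T"
    using regT reg regular_mat_para_adjoint[OF circle regT]
    by (simp add: rat_eval_mat_mult regular_mat_mult rat_eval_mat_para_adjoint[OF circle])
  finally have eq: "map_mat to_complex (W X) = \<dots>" .
  have "nonneg_form ?\<Phi>"
    using psd[OF \<omega>(1) det] by (simp add: psd_def nonneg_form_def)
  then have "nonneg_form (map_mat to_complex (W X))"
    unfolding eq by (rule nonneg_form_congruence[of _ m _ "n + m", rotated 1])
      (auto intro!: carrier_matI)
  then show ?thesis by (rule nonneg_form_of_complex[rotated]) (rule carrier_matI, simp_all)
qed

end

section \<open>The equivalence\<close>
theorem theorem6p4:
  fixes A B Q S R :: "'a :: real_or_complex mat"
  assumes data: "(A, B, Q, S, R) \<in> Sigma_w m n"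
    and q: "q = vec_space.rank m (popov A B Q S R)"
    and full_rank: "vec_space.rank n ((1\<^sub>m n - A) @\<^sub>c (- B)) = n"
  shows "(\<exists>X K L. lure_solution q A B Q S R X K L) \<longleftrightarrow>
    (\<forall>\<omega>\<in>{0..<2 * pi}. det (cis \<omega> \<cdot>\<^sub>m 1\<^sub>m n - map_mat to_complex A) \<noteq> 0 \<longrightarrow>
        psd (map_mat (rat_eval (cis \<omega>)) (popov A B Q S R))) \<and>
    (\<exists>Y\<^sub>\<mu> \<in> carrier_mat n (n + m). \<exists>Y\<^sub>x \<in> carrier_mat n (n + m). \<exists>Y\<^sub>u \<in> carrier_mat m (n + m).
     \<exists>Z\<^sub>\<mu> \<in> carrier_mat n (n + q). \<exists>Z\<^sub>x \<in> carrier_mat n (n + q). \<exists>Z\<^sub>u \<in> carrier_mat m (n + q).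
      let M = palindromic_mat A B Q S R; Y = Y\<^sub>\<mu> @\<^sub>r Y\<^sub>x @\<^sub>r Y\<^sub>u; Z = Z\<^sub>\<mu> @\<^sub>r Z\<^sub>x @\<^sub>r Z\<^sub>u in
        vec_space.rank n (((1\<^sub>m n - A) @\<^sub>c (- B)) * (Y\<^sub>x @\<^sub>r Y\<^sub>u)) = n \<and>
        maximally_neutral (mat_adjoint M - M) (mat_image Y) \<and>
        (\<exists>E\<^sub>1 \<in> carrier_mat (n + q) (n + m). \<exists>A\<^sub>1 \<in> carrier_mat (n + q) (n + m).
          palindromic_pencil A B Q S R * map_mat (\<lambda>c. [:c:]) Y =
          map_mat (\<lambda>c. [:c:]) Z * pencil E\<^sub>1 A\<^sub>1))"
    (is "?lure \<longleftrightarrow> ?psd \<and> ?deflating")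
proof -
  interpret lure_data A B Q S R n m by unfold_locales (rule data)
  let ?N = "n + (n + m)"
  have F: "F \<in> carrier_mat n (n + m)" and J: "J \<in> carrier_mat n (n + m)" and H: "H \<in> carrier_mat n (n + m)"
    by (rule carrier_matI; simp)+
  have M: "\<A> \<in> carrier_mat ?N ?N" "mat_adjoint \<A> \<in> carrier_mat ?N ?N"
    by (rule carrier_matI; simp add: palindromic_mat_blocks)+
  obtain Fi where Fi: "Fi \<in> carrier_mat (n + m) n" "F * Fi = 1\<^sub>m n"
    using vec_space.full_row_rank_right_inverse[OF F full_rank] by blast
  have pencil_iff: "palindromic_pencil A B Q S R * map_mat (\<lambda>c. [:c:]) Y =
      map_mat (\<lambda>c. [:c:]) Z * pencil E\<^sub>1 A\<^sub>1 \<longleftrightarrow> mat_adjoint \<A> * Y = Z * E\<^sub>1 \<and> \<A> * Y = Z * A\<^sub>1"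
    if "Y \<in> carrier_mat ?N (n + m)" "Z \<in> carrier_mat ?N (n + q)"
      "E\<^sub>1 \<in> carrier_mat (n + q) (n + m)" "A\<^sub>1 \<in> carrier_mat (n + q) (n + m)" for Y Z E\<^sub>1 A\<^sub>1
    unfolding palindromic_pencil_def pencil_mult_const[OF M(2,1) that(1)] const_mult_pencil[OF that(3,4,2)]
    by (rule pencil_inject) (rule mult_carrier_mat[OF M(2) that(1)] mult_carrier_mat[OF M(1) that(1)]
        mult_carrier_mat[OF that(2,3)] mult_carrier_mat[OF that(2,4)])+
  show ?thesis
  proof (intro iffI conjI)
    assume ?lure
    then obtain X K L where X: "X \<in> carrier_mat n n" "mat_adjoint X = X"
      and KL: "K \<in> carrier_mat q n" "L \<in> carrier_mat q m"
      and W: "W X = mat_adjoint (K @\<^sub>c L) * (K @\<^sub>c L)"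
      unfolding lure_solution_iff by blast
    define D where "D = K @\<^sub>c L"
    have D: "D \<in> carrier_mat q (n + m)" "W X = mat_adjoint D * D"
      using KL W by (auto simp: D_def)
    show ?psd
      using psd_popov_of_gram[OF X(1) D] by (simp add: cis_cnj cis_mult)
    show ?deflating
    proof -
      \<comment> \<open>The graph over the identity; the sign is the one that makes \<open>W(X)\<close> appear in the pencil.\<close>
      define P where "P = (- X) * F"
      have X': "- X \<in> carrier_mat n n" "mat_adjoint (- X) = - X"
        using X by (simp_all add: mat_adjoint_uminus)
      have P: "P \<in> carrier_mat n (n + m)" unfolding P_def using X'(1) F by (rule mult_carrier_mat)
      obtain V\<^sub>x V\<^sub>u where V: "V\<^sub>x \<in> carrier_mat n (n + m)" "V\<^sub>u \<in> carrier_mat m (n + m)"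
        "(1\<^sub>m (n + m) :: 'a mat) = V\<^sub>x @\<^sub>r V\<^sub>u" using split_rows[OF one_carrier_mat] by metis
      define Z\<^sub>\<mu> where "Z\<^sub>\<mu> = (1\<^sub>m n @\<^sub>c 0\<^sub>m n q :: 'a mat)"
      have Z\<^sub>\<mu>: "Z\<^sub>\<mu> \<in> carrier_mat n (n + q)" by (rule carrier_matI) (simp_all add: Z\<^sub>\<mu>_def)
      have "mat_adjoint F * X @\<^sub>c mat_adjoint D \<in> carrier_mat (n + m) (n + q)"
        using X(1) D(1) by (intro carrier_matI) auto
      then obtain Z\<^sub>x Z\<^sub>u where Z: "Z\<^sub>x \<in> carrier_mat n (n + q)" "Z\<^sub>u \<in> carrier_mat m (n + q)"
        "mat_adjoint F * X @\<^sub>c mat_adjoint D = Z\<^sub>x @\<^sub>r Z\<^sub>u" by (rule split_rows)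
      have rank: "vec_space.rank n (F * (V\<^sub>x @\<^sub>r V\<^sub>u)) = n"
        using full_rank F by (simp flip: V(3))
      have max: "maximally_neutral (mat_adjoint \<A> - \<A>) (mat_image (P @\<^sub>r V\<^sub>x @\<^sub>r V\<^sub>u))"
        using maximally_neutral_graph[OF X' Fi] by (simp add: P_def flip: V(3))
      have E: "J @\<^sub>r D \<in> carrier_mat (n + q) (n + m)" "H @\<^sub>r D \<in> carrier_mat (n + q) (n + m)"
        using J H D(1) by blast+
      have "mat_adjoint \<A> * (P @\<^sub>r V\<^sub>x @\<^sub>r V\<^sub>u) = (Z\<^sub>\<mu> @\<^sub>r Z\<^sub>x @\<^sub>r Z\<^sub>u) * (J @\<^sub>r D)"
        "\<A> * (P @\<^sub>r V\<^sub>x @\<^sub>r V\<^sub>u) = (Z\<^sub>\<mu> @\<^sub>r Z\<^sub>x @\<^sub>r Z\<^sub>u) * (H @\<^sub>r D)"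
        using deflating_of_gram[OF X D] by (simp_all add: P_def Z\<^sub>\<mu>_def flip: V(3) Z(3))
      moreover have "P @\<^sub>r V\<^sub>x @\<^sub>r V\<^sub>u \<in> carrier_mat ?N (n + m)"
        "Z\<^sub>\<mu> @\<^sub>r Z\<^sub>x @\<^sub>r Z\<^sub>u \<in> carrier_mat ?N (n + q)"
        using P V(1,2) Z\<^sub>\<mu> Z(1,2) by (blast intro: carrier_append_rows)+
      ultimately have "palindromic_pencil A B Q S R * map_mat (\<lambda>c. [:c:]) (P @\<^sub>r V\<^sub>x @\<^sub>r V\<^sub>u) =
          map_mat (\<lambda>c. [:c:]) (Z\<^sub>\<mu> @\<^sub>r Z\<^sub>x @\<^sub>r Z\<^sub>u) * pencil (J @\<^sub>r D) (H @\<^sub>r D)"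
        using pencil_iff E by blast
      then show ?thesis
        using P V(1,2) Z\<^sub>\<mu> Z(1,2) rank max E unfolding Let_def by blast
    qed
  next
    assume "?psd \<and> ?deflating"
    then have psd: ?psd and deflating: ?deflating by blast+
    from deflating obtain Y\<^sub>\<mu> Y\<^sub>x Y\<^sub>u Z\<^sub>\<mu> Z\<^sub>x Z\<^sub>u E\<^sub>1 A\<^sub>1 where
      Y: "Y\<^sub>\<mu> \<in> carrier_mat n (n + m)" "Y\<^sub>x \<in> carrier_mat n (n + m)" "Y\<^sub>u \<in> carrier_mat m (n + m)"
      and Z: "Z\<^sub>\<mu> \<in> carrier_mat n (n + q)" "Z\<^sub>x \<in> carrier_mat n (n + q)" "Z\<^sub>u \<in> carrier_mat m (n + q)"
      and rank: "vec_space.rank n (F * (Y\<^sub>x @\<^sub>r Y\<^sub>u)) = n"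
      and max: "maximally_neutral (mat_adjoint \<A> - \<A>) (mat_image (Y\<^sub>\<mu> @\<^sub>r Y\<^sub>x @\<^sub>r Y\<^sub>u))"
      and E\<^sub>1: "E\<^sub>1 \<in> carrier_mat (n + q) (n + m)" and A\<^sub>1: "A\<^sub>1 \<in> carrier_mat (n + q) (n + m)"
      and pencil: "palindromic_pencil A B Q S R * map_mat (\<lambda>c. [:c:]) (Y\<^sub>\<mu> @\<^sub>r Y\<^sub>x @\<^sub>r Y\<^sub>u) =
          map_mat (\<lambda>c. [:c:]) (Z\<^sub>\<mu> @\<^sub>r Z\<^sub>x @\<^sub>r Z\<^sub>u) * pencil E\<^sub>1 A\<^sub>1"
      unfolding Let_def by blast
    define V where "V = Y\<^sub>x @\<^sub>r Y\<^sub>u"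
    define Z where "Z = Z\<^sub>\<mu> @\<^sub>r Z\<^sub>x @\<^sub>r Z\<^sub>u"
    have V: "V \<in> carrier_mat (n + m) (n + m)" unfolding V_def using Y(2,3) by (rule carrier_append_rows)
    have YV: "Y\<^sub>\<mu> @\<^sub>r V \<in> carrier_mat ?N (n + m)" using Y(1) V by (rule carrier_append_rows)
    have Zc: "Z \<in> carrier_mat ?N (n + q)" unfolding Z_def using Z by (blast intro: carrier_append_rows)
    have MY: "mat_adjoint \<A> * (Y\<^sub>\<mu> @\<^sub>r V) = Z * E\<^sub>1" "\<A> * (Y\<^sub>\<mu> @\<^sub>r V) = Z * A\<^sub>1"
      using pencil pencil_iff[OF YV Zc E\<^sub>1 A\<^sub>1] by (simp_all add: V_def Z_def)
    obtain N where N: "N \<in> carrier_mat (n + m) n" "F * V * N = 1\<^sub>m n"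
      using vec_space.full_row_rank_right_inverse[OF mult_carrier_mat[OF F V]] rank unfolding V_def by blast
    obtain X\<^sub>0 C where X\<^sub>0: "X\<^sub>0 \<in> carrier_mat n n" "mat_adjoint X\<^sub>0 = X\<^sub>0"
      and C: "C \<in> carrier_mat (n + m) (n + m)" "X\<^sub>0 * F @\<^sub>r 1\<^sub>m (n + m) = (Y\<^sub>\<mu> @\<^sub>r V) * C"
      using maximally_neutral_normal_form[OF Y(1) V N max[folded V_def]] by blast
    define X where "X = - X\<^sub>0"
    have X: "X \<in> carrier_mat n n" "mat_adjoint X = X"
      using X\<^sub>0 by (simp_all add: X_def mat_adjoint_uminus)
    have YC: "(- X) * F @\<^sub>r 1\<^sub>m (n + m) = (Y\<^sub>\<mu> @\<^sub>r V) * C" using C(2) by (simp add: X_def)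
    have "mat_adjoint \<A> * ((- X) * F @\<^sub>r 1\<^sub>m (n + m)) = Z * (E\<^sub>1 * C)"
      "\<A> * ((- X) * F @\<^sub>r 1\<^sub>m (n + m)) = Z * (A\<^sub>1 * C)"
      unfolding YC assoc_mult_mat[OF M(2) YV C(1), symmetric] assoc_mult_mat[OF M(1) YV C(1), symmetric] MY
        assoc_mult_mat[OF Zc E\<^sub>1 C(1)] assoc_mult_mat[OF Zc A\<^sub>1 C(1)] by (rule refl)+
    then obtain r P C' where r: "r \<le> q" and P: "P \<in> carrier_mat (n + m) r"
      and C': "C' \<in> carrier_mat r (n + m)" and PC: "W X = P * C'"
      using lure_mat_factorization_of_deflating[OF X Fi Zc mult_carrier_mat[OF E\<^sub>1 C(1)] mult_carrier_mat[OF A\<^sub>1 C(1)]]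
      by blast
    have nonneg: "nonneg_form (W X)"
      using nonneg_lure_mat_of_popov[OF X P C' PC] r psd q by blast
    have W: "W X \<in> carrier_mat (n + m) (n + m)" by (rule carrier_matI) simp_all
    obtain D where D: "D \<in> carrier_mat q (n + m)" "W X = mat_adjoint D * D"
      using nonneg_form_factorization[OF W lure_mat_hermitian[OF X] nonneg P C' PC r] by blast
    obtain K L where "K \<in> carrier_mat q n" "L \<in> carrier_mat q m" "D = K @\<^sub>c L"
      using D(1) by (rule split_cols)
    then have "lure_solution q A B Q S R X K L"
      using X D by (simp add: lure_solution_iff)
    then show ?lure by blast
  qed
qed

end
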